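(* For every integer $t$ there exists an integer $k\le 16\,\ell(t-1)+1$ such that the following holds. If $G$ is a graph with no $K_t$ minor and $T$ is a spanning forest of $G$, then there exists a coloring $\phi:E(G)\setminus E(T)\to\{1,\dots,k\}$ such that for every edge $f\in E(T)$ that is not a bridge of $G$, there exists a color $i\in\{1,\dots,k\}$ which occurs an odd number of times on the fundamental cut of $T$ with respect to $f$.
   Context: The star-arboricity of a graph is the minimum number of star forests (forests each of whose components has diameter at most 2) into which its edge set can be decomposed. For an integer $s$, $\ell(s)$ denotes the largest star-arboricity of any graph with no $K_s$ minor. A spanning forest of $G$ is a maximal acyclic subgraph of $G$. For a spanning forest $T$ of $G$ and $f\in E(T)$, deleting $f$ from $T$ splits the component of $T$ containing $f$ into two components; the fundamental cut of $T$ with respect to $f$ is the set of all edges of $G$ joining the vertex sets of these two components (it contains $f$). "Occurs on the fundamental cut" refers to edges of the cut lying in $E(G)\setminus E(T)$, the domain of $\phi$. *)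

theory Defs
  imports Main
begin

definition graph :: "'a set \<Rightarrow> 'a set set \<Rightarrow> bool" where
  "graph V E \<longleftrightarrow> finite V \<and> (\<forall>e\<in>E. \<exists>u v. e = {u, v} \<and> u \<noteq> v \<and> u \<in> V \<and> v \<in> V)"

definition reach :: "'a set set \<Rightarrow> 'a \<Rightarrow> 'a \<Rightarrow> bool" where
  "reach F u v \<longleftrightarrow> (u, v) \<in> {(x, y). {x, y} \<in> F}\<^sup>*"

definition connected_set :: "'a set set \<Rightarrow> 'a set \<Rightarrow> bool" where
  "connected_set E S \<longleftrightarrow> S \<noteq> {} \<and>
     (\<forall>u\<in>S. \<forall>v\<in>S. reach {e\<in>E. e \<subseteq> S} u v)"

definition has_K_minor :: "'a set \<Rightarrow> 'a set set \<Rightarrow> nat \<Rightarrow> bool" where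
  "has_K_minor V E t \<longleftrightarrow> (\<exists>B :: nat \<Rightarrow> 'a set.
     (\<forall>i<t. B i \<subseteq> V \<and> connected_set E (B i)) \<and>
     (\<forall>i<t. \<forall>j<t. i \<noteq> j \<longrightarrow> B i \<inter> B j = {} \<and> (\<exists>u\<in>B i. \<exists>v\<in>B j. {u, v} \<in> E)))"

text \<open>An edge set is acyclic iff no edge lies on a cycle, i.e. the endpoints of
  every edge are disconnected once that edge is removed.\<close>
definition forest :: "'a set set \<Rightarrow> bool" where
  "forest F \<longleftrightarrow> (\<forall>u v. {u, v} \<in> F \<longrightarrow> \<not> reach (F - {{u, v}}) u v)"

definition spanning_forest :: "'a set set \<Rightarrow> 'a set set \<Rightarrow> bool" where
  "spanning_forest E T \<longleftrightarrow> T \<subseteq> E \<and> forest T \<and> (\<forall>e\<in>E - T. \<not> forest (insert e T))"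

definition star_forest :: "'a set set \<Rightarrow> bool" where
  "star_forest F \<longleftrightarrow> forest F \<and>
     (\<forall>u v. reach F u v \<longrightarrow> u = v \<or> {u, v} \<in> F \<or> (\<exists>w. {u, w} \<in> F \<and> {w, v} \<in> F))"

definition star_arboricity :: "'a set set \<Rightarrow> nat" where
  "star_arboricity E = (LEAST k. \<exists>c :: 'a set \<Rightarrow> nat.
      (\<forall>e\<in>E. c e < k) \<and> (\<forall>i<k. star_forest {e\<in>E. c e = i}))"

text \<open>\<ell>(s): largest star-arboricity of a (finite) graph with no K_s minor.
  Every finite graph is isomorphic to one on natural-number vertices.\<close>
definition ell :: "nat \<Rightarrow> nat" where
  "ell s = Sup {star_arboricity E | (V :: nat set) E. graph V E \<and> \<not> has_K_minor V E s}"

definition bridge :: "'a set set \<Rightarrow> 'a set \<Rightarrow> bool" where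
  "bridge E f \<longleftrightarrow> f \<in> E \<and> (\<exists>u v. f = {u, v} \<and> \<not> reach (E - {f}) u v)"

definition fund_cut :: "'a set set \<Rightarrow> 'a set set \<Rightarrow> 'a set \<Rightarrow> 'a set set" where
  "fund_cut E T f = {e\<in>E. \<exists>a b x y. f = {a, b} \<and> e = {x, y} \<and>
      reach (T - {f}) a x \<and> reach (T - {f}) b y}"

end

theory Submission
  imports Defs
begin

text \<open>
  A nowhere-zero flow with values in the group of 3-bit vectors colours the edges outside \<open>T\<close> with its
  eight values: its value on a tree edge \<open>f\<close> is the sum of its values on the rest of the fundamental
  cut of \<open>f\<close>, so if every colour occurred an even number of times there, the flow would vanish
  on \<open>f\<close>. By Jaeger's 8-flow theorem such a flow exists on the non-bridges of every graph, hence
  \<open>k = 8\<close> suffices as soon as \<open>ell (t - 1) \<ge> 1\<close>, in particular for \<open>t \<ge> 4\<close>; for \<open>t \<le> 3\<close> every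
  edge is a bridge. The 8-flow theorem is proved by Seymour's closure argument. That
  \<open>ell (t - 1) \<ge> 1\<close> is not immediate because \<open>ell\<close> is a supremum of natural numbers, which is
  meaningful only for bounded sets; boundedness comes from Mader's theorem that graphs without a
  \<open>K_s\<close> minor are degenerate.
\<close>

section \<open>Cuts and even edge sets of multigraphs\<close>

text \<open>Over Z_2^3 a flow is a triple of edge sets that meet every cut evenly, and it is nowhere
  zero iff the three sets cover; orientations disappear. Seymour's 6-flow argument combines a
  Z_2-flow with a Z_3-flow. Here Z_2 x Z_2 replaces Z_3, since it also has an element left when two
  are excluded. The price is 8 instead of 6, and 8 still fits under 16 * 1 + 1. The closure argument
  needs every nontrivial cut to have at least 3 edges. Smaller cuts are removed by identifying
  vertices, which creates loops and parallel edges. Hence edges form an abstract type with end maps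
  \<open>s\<close> and \<open>t\<close>: identification changes only the maps and leaves the edge
  set as it is. Parity is demanded of all cuts instead of vertex degrees, so that identification
  just pulls vertex sets back, and paths can be replaced by edge sets with prescribed cut parities.
  The constant \<open>2 ^ s\<close> in the density bound comes from the handshake identity, which
  costs a factor 2 for every additional branch set.\<close>

definition edge_cut :: "('e \<Rightarrow> 'v) \<Rightarrow> ('e \<Rightarrow> 'v) \<Rightarrow> 'v set \<Rightarrow> 'e set" where
  "edge_cut s t S = {e. (s e \<in> S) \<noteq> (t e \<in> S)}"

text \<open>This is a T-join for the pair u, v, described by cuts; it stands in for a path from u to
  v, and symmetric difference for concatenation. Finiteness is demanded because an infinite set has
  \<open>card\<close> 0.\<close>

definition join :: "('e \<Rightarrow> 'v) \<Rightarrow> ('e \<Rightarrow> 'v) \<Rightarrow> 'v \<Rightarrow> 'v \<Rightarrow> 'e set \<Rightarrow> bool" where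
  "join s t u v J \<longleftrightarrow> finite J \<and>
     (\<forall>S. odd (card (J \<inter> edge_cut s t S)) \<longleftrightarrow> (u \<in> S) \<noteq> (v \<in> S))"

text \<open>These are the finite members of the cycle space, described as the orthogonal complement
  of the cuts.\<close>

definition even_set :: "('e \<Rightarrow> 'v) \<Rightarrow> ('e \<Rightarrow> 'v) \<Rightarrow> 'e set \<Rightarrow> bool" where
  "even_set s t C \<longleftrightarrow> finite C \<and> (\<forall>S. even (card (C \<inter> edge_cut s t S)))"

definition induced :: "'e set \<Rightarrow> ('e \<Rightarrow> 'v) \<Rightarrow> ('e \<Rightarrow> 'v) \<Rightarrow> 'v set \<Rightarrow> 'e set" where
  "induced E s t W = {e\<in>E. s e \<in> W \<and> t e \<in> W}"

lemma even_card_sym_diff: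
  assumes "finite A" "finite B"
  shows "even (card (sym_diff A B)) \<longleftrightarrow> (even (card A) \<longleftrightarrow> even (card B))"
proof -
  have a: "card A = card (A - B) + card (A \<inter> B)"
    using assms by (metis card_Int_Diff add.commute)
  have b: "card B = card (B - A) + card (A \<inter> B)"
    using assms by (metis card_Int_Diff add.commute inf_commute)
  have "card (sym_diff A B) = card (A - B) + card (B - A)"
    using assms by (intro card_Un_disjoint) auto
  then show ?thesis using a b by (metis even_add)
qed

lemma sym_diff_Int: "sym_diff A B \<inter> K = sym_diff (A \<inter> K) (B \<inter> K)"
  by blast

lemma join_parity: "join s t u v J \<Longrightarrow> odd (card (J \<inter> edge_cut s t S)) \<longleftrightarrow> (u \<in> S) \<noteq> (v \<in> S)"
  by (simp add: join_def)

lemma even_set_iff_join: "even_set s t C \<longleftrightarrow> join s t u u C"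
  by (simp add: even_set_def join_def)

lemma join_sym_diff:
  assumes "join s t u v J" "join s t v w K"
  shows "join s t u w (sym_diff J K)"
  using assms unfolding join_def sym_diff_Int
  by (auto simp: even_card_sym_diff)

lemma join_commute: "join s t u v J \<Longrightarrow> join s t v u J"
  unfolding join_def by auto

lemma join_empty: "join s t u u {}"
  unfolding join_def by auto

lemma join_edge: "join s t (s e) (t e) {e}"
proof -
  have "{e} \<inter> edge_cut s t S = (if (s e \<in> S) \<noteq> (t e \<in> S) then {e} else {})" for S
    by (auto simp: edge_cut_def)
  then show ?thesis unfolding join_def by auto
qed

lemma even_set_sym_diff:
  "even_set s t A \<Longrightarrow> even_set s t B \<Longrightarrow> even_set s t (sym_diff A B)"
  by (metis even_set_iff_join join_sym_diff)

lemma even_set_empty: "even_set s t {}"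
  by (simp add: even_set_def)

lemma edge_cut_sym_diff:
  "edge_cut s t (sym_diff S S') = sym_diff (edge_cut s t S) (edge_cut s t S')"
  by (auto simp: edge_cut_def)

section \<open>Two edge-disjoint paths\<close>

definition cut_sign :: "('e \<Rightarrow> 'v) \<Rightarrow> ('e \<Rightarrow> 'v) \<Rightarrow> 'v set \<Rightarrow> 'e \<Rightarrow> int" where
  "cut_sign s t S e = of_bool (s e \<in> S) - of_bool (t e \<in> S)"

text \<open>The net flow out of every vertex set is prescribed; singletons give conservation at
  vertices. A negative value means flow from \<open>t e\<close> to \<open>s e\<close>.\<close>

definition flow :: "'e set \<Rightarrow> ('e \<Rightarrow> 'v) \<Rightarrow> ('e \<Rightarrow> 'v) \<Rightarrow> 'v \<Rightarrow> 'v \<Rightarrow> int \<Rightarrow> ('e \<Rightarrow> int) \<Rightarrow> bool" where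
  "flow F s t a b v f \<longleftrightarrow>
     (\<forall>S. (\<Sum>e\<in>F. f e * cut_sign s t S e) = v * (of_bool (a \<in> S) - of_bool (b \<in> S)))"

lemma flow_add:
  assumes "flow F s t a b v f" "flow F s t a b w g"
  shows "flow F s t a b (v + w) (\<lambda>e. f e + g e)"
  using assms unfolding flow_def by (simp add: distrib_right sum.distrib)

lemma flow_extend:
  assumes "flow F s t a x 1 g" "finite F" "e \<in> F"
    and "\<And>S. r * cut_sign s t S e = of_bool (x \<in> S) - of_bool (y \<in> S)"
  shows "flow F s t a y 1 (\<lambda>e'. g e' + (if e' = e then r else 0))"
  unfolding flow_def
proof
  fix S
  have "(\<Sum>e'\<in>F. (g e' + (if e' = e then r else 0)) * cut_sign s t S e')
      = (\<Sum>e'\<in>F. g e' * cut_sign s t S e') + (\<Sum>e'\<in>F. (if e' = e then r * cut_sign s t S e else 0))"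
    by (subst sum.distrib[symmetric], rule sum.cong) (auto simp: distrib_right)
  also have "(\<Sum>e'\<in>F. (if e' = e then r * cut_sign s t S e else 0)) = r * cut_sign s t S e"
    using assms(2,3) by simp
  finally show "(\<Sum>e'\<in>F. (g e' + (if e' = e then r else 0)) * cut_sign s t S e')
      = 1 * (of_bool (a \<in> S) - of_bool (y \<in> S))"
    using assms(1,4) unfolding flow_def by simp
qed

text \<open>One Ford-Fulkerson step with unit capacities. If the set S of vertices reached by
  augmentations misses b, then by maximality every edge leaving S is saturated outwards, so v equals
  the size of that cut, against \<open>cuts\<close>.\<close>

lemma flow_augment:
  assumes fin: "finite V" "finite F" and ends: "\<And>e. e \<in> F \<Longrightarrow> s e \<in> V \<and> t e \<in> V"
    and a: "a \<in> V"
    and f: "flow F s t a b v f" "\<And>e. e \<in> F \<Longrightarrow> \<bar>f e\<bar> \<le> 1"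
    and cuts: "\<And>S. a \<in> S \<Longrightarrow> b \<notin> S \<Longrightarrow> v < int (card (F \<inter> edge_cut s t S))"
  obtains f' where "flow F s t a b (v + 1) f'" "\<And>e. e \<in> F \<Longrightarrow> \<bar>f' e\<bar> \<le> 1"
proof -
  \<comment> \<open>The support of \<open>g\<close> stays inside S, so \<open>g\<close> vanishes on
    an edge leaving S and can be continued along that edge within capacity.\<close>
  define augments where "augments S x g \<longleftrightarrow> flow F s t a x 1 g \<and> (\<forall>e\<in>F. \<bar>f e + g e\<bar> \<le> 1) \<and>
      (\<forall>e. g e \<noteq> 0 \<longrightarrow> s e \<in> S \<and> t e \<in> S)" for S x g
  define P where "P S \<longleftrightarrow> S \<subseteq> V \<and> a \<in> S \<and> (\<forall>x\<in>S. \<exists>g. augments S x g)" for S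
  have "augments {a} a (\<lambda>_. 0)"
    using f(2) by (simp add: augments_def flow_def)
  then have "P {a}"
    using a by (auto simp: P_def)
  moreover have "finite {S. P S}"
    by (rule finite_subset[of _ "Pow V"]) (auto simp: P_def fin)
  ultimately obtain S where S: "P S" and max: "\<And>S'. P S' \<Longrightarrow> S \<subseteq> S' \<Longrightarrow> S = S'"
    using finite_has_maximal[of "{S. P S}"] by blast
  have "b \<in> S"
  proof (rule ccontr)
    assume b: "b \<notin> S"
    have grow: False
      if e: "e \<in> F" and x: "x \<in> S" and y: "y \<in> V" "y \<notin> S" and xy: "{x, y} = {s e, t e}"
        and r: "\<bar>f e + r\<bar> \<le> 1" "\<And>S. r * cut_sign s t S e = of_bool (x \<in> S) - of_bool (y \<in> S)"
      for e x y r
    proof -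
      obtain g where g: "augments S x g"
        using S x by (auto simp: P_def)
      have g0: "g e = 0"
        using g y(2) xy unfolding augments_def by (metis insert_iff singletonD)
      have "augments (insert y S) y (\<lambda>e'. g e' + (if e' = e then r else 0))"
        unfolding augments_def
      proof (intro conjI ballI allI impI)
        show "flow F s t a y 1 (\<lambda>e'. g e' + (if e' = e then r else 0))"
          using g fin(2) e r(2) by (intro flow_extend) (auto simp: augments_def)
        show "\<bar>f e' + (g e' + (if e' = e then r else 0))\<bar> \<le> 1" if "e' \<in> F" for e'
          using g that r(1) g0 unfolding augments_def by auto
        fix e' assume ne: "g e' + (if e' = e then r else 0) \<noteq> 0"
        have "s e \<in> {x, y}" "t e \<in> {x, y}" using xy by auto
        with ne g x show "s e' \<in> insert y S" "t e' \<in> insert y S"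
          unfolding augments_def by (auto split: if_splits)
      qed
      moreover have "augments (insert y S) x' g'" if "augments S x' g'" for x' g'
        using that unfolding augments_def by blast
      ultimately have "P (insert y S)"
        using S y(1) unfolding P_def by (metis insert_iff insert_subset)
      then show False using max y by blast
    qed
    have sat: "f e * cut_sign s t S e = of_bool (e \<in> edge_cut s t S)" if e: "e \<in> F" for e
    proof -
      consider "e \<notin> edge_cut s t S" | "s e \<in> S" "t e \<notin> S" | "s e \<notin> S" "t e \<in> S"
        by (auto simp: edge_cut_def)
      then show ?thesis
      proof cases
        case 1
        then show ?thesis by (auto simp: edge_cut_def cut_sign_def)
      next
        case 2
        have "\<not> f e < 1"
          using grow[of e "s e" "t e" 1] 2 e ends f(2)[OF e] by (auto simp: cut_sign_def)
        then have "f e = 1" using f(2)[OF e] by linarith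
        then show ?thesis using 2 by (simp add: cut_sign_def edge_cut_def)
      next
        case 3
        have "\<not> f e > -1"
          using grow[of e "t e" "s e" "-1"] 3 e ends f(2)[OF e]
          by (auto simp: cut_sign_def insert_commute)
        then have "f e = -1" using f(2)[OF e] by linarith
        then show ?thesis using 3 by (simp add: cut_sign_def edge_cut_def)
      qed
    qed
    have aS: "a \<in> S" using S by (simp add: P_def)
    have "v = (\<Sum>e\<in>F. f e * cut_sign s t S e)"
      using f(1) aS b by (simp add: flow_def)
    also have "\<dots> = (\<Sum>e\<in>F. of_bool (e \<in> edge_cut s t S))"
      by (rule sum.cong) (auto simp: sat)
    also have "\<dots> = int (card (F \<inter> edge_cut s t S))"
      using fin(2) by (simp add: of_bool_def sum.If_cases)
    finally show False using cuts[OF aS b] by simp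
  qed
  then obtain g where "augments S b g"
    using S by (auto simp: P_def)
  then show thesis
    using that flow_add[OF f(1)] unfolding augments_def by blast
qed

text \<open>Two augmentations give a flow of value 2 with values in {-1, 0, 1}, in effect two
  edge-disjoint paths. Its support is even because 2 is, and it meets each cut between a and b
  because the net flow there is nonzero.\<close>

lemma even_set_connecting:
  assumes fin: "finite V" "finite F" and ends: "\<And>e. e \<in> F \<Longrightarrow> s e \<in> V \<and> t e \<in> V"
    and a: "a \<in> V"
    and cuts: "\<And>S. a \<in> S \<Longrightarrow> b \<notin> S \<Longrightarrow> 2 \<le> card (F \<inter> edge_cut s t S)"
  obtains D where "D \<subseteq> F" "even_set s t D" "\<And>S. a \<in> S \<Longrightarrow> b \<notin> S \<Longrightarrow> D \<inter> edge_cut s t S \<noteq> {}"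
proof -
  have 0: "flow F s t a b 0 (\<lambda>_. 0)" by (simp add: flow_def)
  have c0: "0 < int (card (F \<inter> edge_cut s t S))" and c1: "1 < int (card (F \<inter> edge_cut s t S))"
    if "a \<in> S" "b \<notin> S" for S
    using cuts[OF that] by linarith+
  obtain f1 where f1: "flow F s t a b (0 + 1) f1" "\<And>e. e \<in> F \<Longrightarrow> \<bar>f1 e\<bar> \<le> 1"
    using flow_augment[OF fin ends a 0 _ c0] by (metis abs_zero zero_le_one)
  then have f1': "flow F s t a b 1 f1" by simp
  obtain f where f: "flow F s t a b (1 + 1) f" "\<And>e. e \<in> F \<Longrightarrow> \<bar>f e\<bar> \<le> 1"
    using flow_augment[OF fin ends a f1' f1(2) c1] by metis
  define D where "D = {e\<in>F. f e \<noteq> 0}"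
  have par: "even (card (D \<inter> edge_cut s t S)) = even (\<Sum>e\<in>F. f e * cut_sign s t S e)" for S
  proof -
    have "odd (f e * cut_sign s t S e) \<longleftrightarrow> e \<in> D \<inter> edge_cut s t S" if "e \<in> F" for e
    proof -
      have "f e = 0 \<or> f e = 1 \<or> f e = -1" using f(2)[OF that] by linarith
      then show ?thesis using that by (auto simp: D_def cut_sign_def edge_cut_def)
    qed
    then have "{e\<in>F. odd (f e * cut_sign s t S e)} = D \<inter> edge_cut s t S"
      unfolding D_def by blast
    then show ?thesis
      using even_sum_iff[OF fin(2), of "\<lambda>e. f e * cut_sign s t S e"] by simp
  qed
  show thesis
  proof
    show "D \<subseteq> F" by (auto simp: D_def)
    then show "even_set s t D"
      using f(1) fin(2) unfolding even_set_def par by (auto simp: flow_def finite_subset)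
    fix S assume S: "a \<in> S" "b \<notin> S"
    show "D \<inter> edge_cut s t S \<noteq> {}"
    proof
      assume empty: "D \<inter> edge_cut s t S = {}"
      have "(\<Sum>e\<in>F. f e * cut_sign s t S e) = 0"
        by (rule sum.neutral) (use empty in \<open>auto simp: D_def cut_sign_def edge_cut_def\<close>)
      then show False using f(1) S by (simp add: flow_def)
    qed
  qed
qed

section \<open>The 8-flow theorem\<close>

text \<open>\<open>coverable X\<close> says that a \<open>Z_2 \<times> Z_2\<close>-flow is nowhere zero outside \<open>X\<close>.\<close>

definition coverable :: "'e set \<Rightarrow> ('e \<Rightarrow> 'v) \<Rightarrow> ('e \<Rightarrow> 'v) \<Rightarrow> 'e set \<Rightarrow> bool" where
  "coverable E s t X \<longleftrightarrow>
     (\<exists>A B. even_set s t A \<and> even_set s t B \<and> A \<subseteq> E \<and> B \<subseteq> E \<and> E - X \<subseteq> A \<union> B)"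

lemma coverable_mono: "coverable E s t X \<Longrightarrow> X \<subseteq> Y \<Longrightarrow> coverable E s t Y"
  unfolding coverable_def by blast

text \<open>Of the four multiples of \<open>D\<close> by elements of \<open>Z_2 \<times> Z_2\<close>, each of the at most two edges of
  \<open>D\<close> outside \<open>X\<close> excludes one.\<close>

lemma coverable_remove_even_set:
  assumes cov: "coverable E s t (X \<union> D)" and D: "even_set s t D" "D \<subseteq> E" and le: "D - X \<subseteq> {x, y}"
  shows "coverable E s t X"
proof -
  obtain A B where AB: "even_set s t A" "even_set s t B" "A \<subseteq> E" "B \<subseteq> E" "E - (X \<union> D) \<subseteq> A \<union> B"
    using cov unfolding coverable_def by blast
  obtain \<alpha> \<beta> where
    ab: "\<alpha> \<noteq> (x \<in> A) \<or> \<beta> \<noteq> (x \<in> B)" "\<alpha> \<noteq> (y \<in> A) \<or> \<beta> \<noteq> (y \<in> B)"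
    by metis
  define A' where "A' = (if \<alpha> then sym_diff A D else A)"
  define B' where "B' = (if \<beta> then sym_diff B D else B)"
  have mem: "e \<in> A' \<longleftrightarrow> (e \<in> A) \<noteq> (\<alpha> \<and> e \<in> D)" "e \<in> B' \<longleftrightarrow> (e \<in> B) \<noteq> (\<beta> \<and> e \<in> D)" for e
    by (auto simp: A'_def B'_def)
  have "even_set s t A'" "even_set s t B'"
    using AB D even_set_sym_diff unfolding A'_def B'_def by auto
  moreover have "A' \<subseteq> E" "B' \<subseteq> E"
    using AB D by (auto simp: A'_def B'_def)
  moreover have "E - X \<subseteq> A' \<union> B'"
  proof
    fix e assume e: "e \<in> E - X"
    show "e \<in> A' \<union> B'"
    proof (cases "e \<in> D")
      case True
      then have "e = x \<or> e = y" using e le by blast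
      then show ?thesis using ab True by (auto simp: mem)
    next
      case False
      then show ?thesis using e AB(5) by (auto simp: mem)
    qed
  qed
  ultimately show ?thesis unfolding coverable_def by blast
qed

text \<open>An edge e whose ends are joined by J inside X closes up to the even set {e} + J, which
  has only e outside X. So the edges of F are absorbed one at a time.\<close>

lemma coverable_remove_joined:
  assumes "finite F" "F \<subseteq> E" "X \<subseteq> E"
    and joined: "\<And>e. e \<in> F \<Longrightarrow> \<exists>J\<subseteq>X. join s t (s e) (t e) J"
    and "coverable E s t (X \<union> F)"
  shows "coverable E s t X"
  using assms(1,2,4,5)
proof (induction F rule: finite_induct)
  case (insert e F)
  obtain J where J: "J \<subseteq> X" "join s t (s e) (t e) J"
    using insert.prems(2)[of e] by blast
  let ?D = "sym_diff {e} J"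
  have "even_set s t ?D"
    unfolding even_set_iff_join[of _ _ _ "s e"]
    by (rule join_sym_diff[OF join_edge join_commute[OF J(2)]])
  moreover have "coverable E s t (X \<union> F \<union> ?D)"
    by (rule coverable_mono[OF insert.prems(3)]) (use J(1) in blast)
  moreover have "?D \<subseteq> E" "?D - (X \<union> F) \<subseteq> {e, e}"
    using insert.prems(1) assms(3) J(1) by auto
  ultimately have "coverable E s t (X \<union> F)"
    by (metis coverable_remove_even_set)
  then show ?case
    using insert.IH insert.prems by blast
qed simp

section \<open>Seymour's closure in 3-edge-connected multigraphs\<close>

locale multigraph =
  fixes V :: "'v set" and E :: "'e set" and s t :: "'e \<Rightarrow> 'v"
  assumes finite_V: "finite V" and finite_E: "finite E"
    and ends: "e \<in> E \<Longrightarrow> s e \<in> V \<and> t e \<in> V"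
begin

text \<open>The last clause expresses that the Seymour closure of the even set \<open>C\<close>, in which every
  even set with at most two edges outside may be added, contains all edges inside \<open>W\<close>.\<close>

definition closed_part :: "'v set \<Rightarrow> bool" where
  "closed_part W \<longleftrightarrow> W \<subseteq> V \<and> W \<noteq> {} \<and>
     (\<forall>u\<in>W. \<forall>v\<in>W. \<exists>J\<subseteq>induced E s t W. join s t u v J) \<and>
     (\<exists>C\<subseteq>induced E s t W. even_set s t C \<and>
       (\<forall>Y\<subseteq>E. coverable E s t (induced E s t W \<union> Y) \<longrightarrow> coverable E s t (C \<union> Y)))"

lemma closed_part_singleton:
  assumes "r \<in> V"
  shows "closed_part {r}"
proof -
  have "coverable E s t Y" if Y: "Y \<subseteq> E" "coverable E s t (induced E s t {r} \<union> Y)" for Y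
  proof (rule coverable_remove_joined[of "induced E s t {r}"])
    show "finite (induced E s t {r})" "induced E s t {r} \<subseteq> E"
      using finite_E by (auto simp: induced_def)
    \<comment> \<open>Edges induced by \<open>{r}\<close> are loops, so the empty set joins their
      ends.\<close>
    show "\<exists>J\<subseteq>Y. join s t (s e) (t e) J" if "e \<in> induced E s t {r}" for e
      using that join_empty[of s t r] by (intro exI[of _ "{}"]) (auto simp: induced_def)
  qed (use Y in \<open>auto simp: Un_commute\<close>)
  then show ?thesis
    using assms join_empty even_set_empty unfolding closed_part_def
    by (auto intro!: exI[of _ "{}"])
qed

text \<open>L plays the role of a leaf in the forest of 2-edge-connected components of the graph
  induced by U. It is found as a minimal nonempty part with at most one edge to the rest of U, which
  avoids constructing components.\<close>

lemma leaf_part: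
  assumes U: "U \<subseteq> V" "U \<noteq> {}"
  obtains L where "L \<subseteq> U" "L \<noteq> {}" "card (induced E s t U \<inter> edge_cut s t L) \<le> 1"
    "\<And>S. S \<inter> L \<noteq> {} \<Longrightarrow> L - S \<noteq> {} \<Longrightarrow> 2 \<le> card (induced E s t L \<inter> edge_cut s t S)"
proof -
  let ?H = "induced E s t U"
  have finH: "finite ?H" using finite_E by (simp add: induced_def)
  define P where "P L \<longleftrightarrow> L \<subseteq> U \<and> L \<noteq> {} \<and> card (?H \<inter> edge_cut s t L) \<le> 1" for L
  have "?H \<inter> edge_cut s t U = {}" by (auto simp: induced_def edge_cut_def)
  then have "P U" using U by (simp add: P_def)
  moreover have "finite {L. P L}"
    by (rule finite_subset[of _ "Pow U"]) (use U finite_V finite_subset in \<open>auto simp: P_def\<close>)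
  ultimately obtain L where L: "P L" and min: "\<And>L'. P L' \<Longrightarrow> L' \<subseteq> L \<Longrightarrow> L = L'"
    using finite_has_minimal[of "{L. P L}"] by blast
  show thesis
  proof (rule that[of L])
    show "L \<subseteq> U" "L \<noteq> {}" "card (?H \<inter> edge_cut s t L) \<le> 1"
      using L by (auto simp: P_def)
    fix S assume S: "S \<inter> L \<noteq> {}" "L - S \<noteq> {}"
    let ?FS = "induced E s t L \<inter> edge_cut s t S" and ?K = "?H \<inter> edge_cut s t L"
    have finFS: "finite ?FS" using finite_E by (simp add: induced_def)
    have big: "2 \<le> card (?H \<inter> edge_cut s t L')" if "L' \<subset> L" "L' \<noteq> {}" for L'
    proof -
      have "\<not> P L'" using min[of L'] that by blast
      then show ?thesis using that L by (auto simp: P_def)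
    qed
    have sub: "?H \<inter> edge_cut s t (S \<inter> L) \<subseteq> ?FS \<union> (?K \<inter> edge_cut s t (S \<inter> L))"
      "?H \<inter> edge_cut s t (L - S) \<subseteq> ?FS \<union> (?K \<inter> edge_cut s t (L - S))"
      by (auto simp: induced_def edge_cut_def)
    \<comment> \<open>The only edge that may leave L inside U has one end in L, so it touches at
      most one of \<open>S \<inter> L\<close> and \<open>L - S\<close>. The other part has all its
      cut edges inside L, and by minimality there are at least two.\<close>
    have "?K \<inter> edge_cut s t (S \<inter> L) = {} \<or> ?K \<inter> edge_cut s t (L - S) = {}"
    proof (rule ccontr)
      assume "\<not> ?thesis"
      then obtain e e' where e: "e \<in> ?K \<inter> edge_cut s t (S \<inter> L)" "e' \<in> ?K \<inter> edge_cut s t (L - S)"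
        by blast
      then have "e \<noteq> e'" by (auto simp: edge_cut_def)
      moreover have "card ?K \<le> Suc 0" "finite ?K" using L finH by (auto simp: P_def)
      ultimately show False using e card_le_Suc0_iff_eq[of ?K] by auto
    qed
    then have "?H \<inter> edge_cut s t (S \<inter> L) \<subseteq> ?FS \<or> ?H \<inter> edge_cut s t (L - S) \<subseteq> ?FS"
      using sub by blast
    moreover have "S \<inter> L \<subset> L" "L - S \<subset> L" using S by auto
    ultimately show "2 \<le> card ?FS"
      using big[of "S \<inter> L"] big[of "L - S"] S card_mono[OF finFS] by (meson order_trans)
  qed
qed

text \<open>The even set supplied by \<open>even_set_connecting\<close> may contain cycles away from
  u. Keeping only the component Q of u makes it connected, and v lies in Q because every cut between
  u and v is met.\<close>

lemma connected_even_set: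
  assumes L: "L \<subseteq> V" "u \<in> L" "v \<in> L"
    and cuts: "\<And>S. S \<inter> L \<noteq> {} \<Longrightarrow> L - S \<noteq> {} \<Longrightarrow> 2 \<le> card (induced E s t L \<inter> edge_cut s t S)"
  obtains Q D where "u \<in> Q" "v \<in> Q" "Q \<subseteq> L" "D \<subseteq> induced E s t Q" "even_set s t D"
    "\<And>x. x \<in> Q \<Longrightarrow> \<exists>J\<subseteq>D. join s t u x J"
proof -
  have finL: "finite L" "finite (induced E s t L)"
    using L finite_V finite_E finite_subset by (auto simp: induced_def)
  have endsL: "\<And>e. e \<in> induced E s t L \<Longrightarrow> s e \<in> L \<and> t e \<in> L" by (simp add: induced_def)
  have cuts': "2 \<le> card (induced E s t L \<inter> edge_cut s t S)" if "u \<in> S" "v \<notin> S" for S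
    using cuts[of S] that L by blast
  obtain D where D: "D \<subseteq> induced E s t L" "even_set s t D"
    and Dcut: "\<And>S. u \<in> S \<Longrightarrow> v \<notin> S \<Longrightarrow> D \<inter> edge_cut s t S \<noteq> {}"
    using even_set_connecting[where V = L and F = "induced E s t L", OF finL endsL L(2) cuts'] by blast
  define Q where "Q = {x. \<exists>J\<subseteq>D. join s t u x J}"
  have step: "y \<in> Q" if "x \<in> Q" "e \<in> D" "join s t x y {e}" for x y e
  proof -
    obtain J where "J \<subseteq> D" "join s t u x J" using \<open>x \<in> Q\<close> by (auto simp: Q_def)
    then have "sym_diff J {e} \<subseteq> D" "join s t u y (sym_diff J {e})"
      using that join_sym_diff[of s t u x J y "{e}"] by auto
    then show ?thesis unfolding Q_def by blast
  qed
  have noncrossing: "s e \<in> Q \<longleftrightarrow> t e \<in> Q" if "e \<in> D" for e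
    using step that join_edge join_commute by metis
  have u: "u \<in> Q"
    using join_empty[of s t u] unfolding Q_def by blast
  have v: "v \<in> Q"
    using Dcut[OF u] noncrossing by (auto simp: edge_cut_def)
  have QL: "Q \<subseteq> L"
  proof
    fix x assume "x \<in> Q"
    then obtain J where J: "J \<subseteq> D" "join s t u x J" by (auto simp: Q_def)
    have "J \<inter> edge_cut s t L = {}" using J(1) D(1) by (auto simp: induced_def edge_cut_def)
    then have "\<not> odd (card (J \<inter> edge_cut s t L))" by simp
    then show "x \<in> L" using join_parity[OF J(2), of L] L(2) by blast
  qed
  \<comment> \<open>No edge of D crosses Q, so restricting to Q amounts to replacing the cut of S by
    that of \<open>S \<inter> Q\<close>; parities carry over.\<close>
  have restrict: "J \<inter> induced E s t Q \<inter> edge_cut s t S = J \<inter> edge_cut s t (S \<inter> Q)" if "J \<subseteq> D" for J S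
    using that noncrossing D(1) by (auto simp: induced_def edge_cut_def)
  show thesis
  proof (rule that[OF u v QL])
    show "D \<inter> induced E s t Q \<subseteq> induced E s t Q" by blast
    show "even_set s t (D \<inter> induced E s t Q)"
      using D(2) unfolding even_set_def restrict[OF subset_refl] by simp
    fix x assume x: "x \<in> Q"
    then obtain J where J: "J \<subseteq> D" "join s t u x J" by (auto simp: Q_def)
    have "odd (card (J \<inter> induced E s t Q \<inter> edge_cut s t S)) \<longleftrightarrow> (u \<in> S) \<noteq> (x \<in> S)" for S
    proof -
      have "odd (card (J \<inter> edge_cut s t (S \<inter> Q))) \<longleftrightarrow> (u \<in> S \<inter> Q) \<noteq> (x \<in> S \<inter> Q)"
        by (rule join_parity[OF J(2)])
      then show ?thesis using u x by (simp add: restrict[OF J(1)])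
    qed
    moreover have "finite (J \<inter> induced E s t Q)" using J(2) by (simp add: join_def)
    ultimately have "join s t u x (J \<inter> induced E s t Q)"
      unfolding join_def by (intro conjI allI)
    moreover have "J \<inter> induced E s t Q \<subseteq> D \<inter> induced E s t Q" using J(1) by blast
    ultimately show "\<exists>J\<subseteq>D \<inter> induced E s t Q. join s t u x J" by (intro exI conjI)
  qed
qed

text \<open>A leaf part L of the complement sends two edges e1, e2 to W. A connected even set D in L
  through their ends in L is added to C. Then e1 and e2 close a cycle through W and D with only two
  edges outside, which the closure may absorb, and afterwards everything induced by
  \<open>W \<union> Q\<close> follows.\<close>

lemma closed_part_extend:
  assumes cuts: "\<And>S. S \<subseteq> V \<Longrightarrow> S \<noteq> {} \<Longrightarrow> S \<noteq> V \<Longrightarrow> 3 \<le> card (E \<inter> edge_cut s t S)"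
    and W: "closed_part W" "W \<noteq> V"
  obtains W' where "W \<subset> W'" "closed_part W'"
proof -
  let ?I = "induced E s t"
  have WV: "W \<subseteq> V" "W \<noteq> {}"
    and conn: "\<And>u v. u \<in> W \<Longrightarrow> v \<in> W \<Longrightarrow> \<exists>J\<subseteq>?I W. join s t u v J"
    and "\<exists>C\<subseteq>?I W. even_set s t C \<and>
       (\<forall>Y\<subseteq>E. coverable E s t (?I W \<union> Y) \<longrightarrow> coverable E s t (C \<union> Y))"
    using W(1) by (simp_all add: closed_part_def)
  then obtain C where C: "C \<subseteq> ?I W" "even_set s t C"
    and closure: "\<forall>Y\<subseteq>E. coverable E s t (?I W \<union> Y) \<longrightarrow> coverable E s t (C \<union> Y)"
    by (elim exE conjE)
  obtain L where L: "L \<subseteq> V - W" "L \<noteq> {}" "card (?I (V - W) \<inter> edge_cut s t L) \<le> 1"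
    and Lcuts: "\<And>S. S \<inter> L \<noteq> {} \<Longrightarrow> L - S \<noteq> {} \<Longrightarrow> 2 \<le> card (?I L \<inter> edge_cut s t S)"
    using leaf_part[of "V - W"] WV W(2) by blast
  define M where "M = {e\<in>E. (s e \<in> L \<and> t e \<in> W) \<or> (s e \<in> W \<and> t e \<in> L)}"
  \<comment> \<open>At least 3 edges leave L and at most one of them stays in \<open>V - W\<close>,
    so at least two lead to W.\<close>
  have "E \<inter> edge_cut s t L \<subseteq> (?I (V - W) \<inter> edge_cut s t L) \<union> M"
    using L(1) by (auto simp: M_def induced_def edge_cut_def dest: ends)
  moreover have finM: "finite M" using finite_E by (simp add: M_def)
  ultimately have "card (E \<inter> edge_cut s t L) \<le> card (?I (V - W) \<inter> edge_cut s t L) + card M"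
    using finite_E by (intro order_trans[OF card_mono card_Un_le]) (auto simp: induced_def)
  moreover have "3 \<le> card (E \<inter> edge_cut s t L)"
    using L WV by (intro cuts) auto
  ultimately have "\<not> card M \<le> Suc 0" using L(3) by linarith
  then obtain e1 e2 where e: "e1 \<in> M" "e2 \<in> M" "e1 \<noteq> e2"
    using card_le_Suc0_iff_eq[OF finM] by blast
  have attach: "\<exists>u\<in>L. \<exists>w\<in>W. join s t u w {e} \<and> {s e, t e} = {u, w}" if "e \<in> M" for e
    using that join_edge[of s t e] join_commute[OF join_edge[of s t e]] unfolding M_def by blast
  obtain u1 w1 where 1: "u1 \<in> L" "w1 \<in> W" "join s t u1 w1 {e1}" "{s e1, t e1} = {u1, w1}"
    using attach[OF e(1)] by blast
  obtain u2 w2 where 2: "u2 \<in> L" "w2 \<in> W" "join s t u2 w2 {e2}" "{s e2, t e2} = {u2, w2}"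
    using attach[OF e(2)] by blast
  have LV: "L \<subseteq> V" using L(1) by blast
  obtain Q D where Q: "u1 \<in> Q" "u2 \<in> Q" "Q \<subseteq> L" and D: "D \<subseteq> ?I Q" "even_set s t D"
    and QD: "\<And>x. x \<in> Q \<Longrightarrow> \<exists>J\<subseteq>D. join s t u1 x J"
    using connected_even_set[OF LV 1(1) 2(1) Lcuts] by blast
  let ?W' = "W \<union> Q" and ?X = "?I W \<union> D \<union> {e1, e2}"
  have disj: "W \<inter> Q = {}" using Q(3) L(1) by blast
  have eE: "e1 \<in> E" "e2 \<in> E" using e by (auto simp: M_def)
  have enotin: "e \<notin> ?I W" "e \<notin> ?I Q" if "e \<in> M" for e
    using that L(1) Q(3) by (auto simp: M_def induced_def)
  have "s e1 \<in> ?W' \<and> t e1 \<in> ?W'" "s e2 \<in> ?W' \<and> t e2 \<in> ?W'"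
    using 1 2 Q by (auto simp: doubleton_eq_iff)
  then have XI: "?X \<subseteq> ?I ?W'"
    using D(1) eE by (auto simp: induced_def)
  have from_w1: "\<exists>J\<subseteq>?X. join s t w1 x J" if "x \<in> ?W'" for x
  proof (cases "x \<in> W")
    case True
    obtain J where J: "J \<subseteq> ?I W" "join s t w1 x J"
      using conn[OF 1(2) True] by (elim exE conjE)
    moreover have "J \<subseteq> ?X" using J(1) by blast
    ultimately show ?thesis by (intro exI conjI)
  next
    case False
    then have "x \<in> Q" using that by blast
    from QD[OF this] obtain J where J: "J \<subseteq> D" "join s t u1 x J"
      by (elim exE conjE)
    have "join s t w1 x (sym_diff {e1} J)"
      by (rule join_sym_diff[OF join_commute[OF 1(3)] J(2)])
    moreover have "sym_diff {e1} J \<subseteq> ?X" using J(1) by blast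
    ultimately show ?thesis by (intro exI conjI)
  qed
  have joined: "\<exists>J\<subseteq>?X. join s t x y J" if xy: "x \<in> ?W'" "y \<in> ?W'" for x y
  proof -
    obtain J where J: "J \<subseteq> ?X" "join s t w1 x J" using from_w1[OF xy(1)] by (elim exE conjE)
    obtain K where K: "K \<subseteq> ?X" "join s t w1 y K" using from_w1[OF xy(2)] by (elim exE conjE)
    have "join s t x y (sym_diff J K)"
      by (rule join_sym_diff[OF join_commute[OF J(2)] K(2)])
    moreover have "sym_diff J K \<subseteq> ?X" using J(1) K(1) by blast
    ultimately show ?thesis by (intro exI conjI)
  qed
  have closure': "coverable E s t (C \<union> D \<union> Y)"
    if Y: "Y \<subseteq> E" and cov: "coverable E s t (?I ?W' \<union> Y)" for Y
  proof -
    have DE: "D \<subseteq> E" "?I W \<subseteq> E" "?I ?W' \<subseteq> E" using D(1) by (auto simp: induced_def)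
    \<comment> \<open>\<open>?X\<close> already connects all of \<open>W \<union> Q\<close>, so the
      remaining induced edges are absorbed singly.\<close>
    have X: "coverable E s t (?X \<union> Y)"
    proof (rule coverable_remove_joined[of "?I ?W'"])
      show "finite (?I ?W')" using DE(3) finite_E finite_subset by blast
      show "?I ?W' \<subseteq> E" "?X \<union> Y \<subseteq> E" using DE Y eE by auto
      show "\<exists>J\<subseteq>?X \<union> Y. join s t (s e) (t e) J" if "e \<in> ?I ?W'" for e
        using joined[of "s e" "t e"] that unfolding induced_def by blast
      show "coverable E s t (?X \<union> Y \<union> ?I ?W')"
        by (rule coverable_mono[OF cov]) blast
    qed
    obtain J where J: "J \<subseteq> ?I W" "join s t w1 w2 J"
      using conn[OF 1(2) 2(2)] by (elim exE conjE)
    obtain K where K: "K \<subseteq> D" "join s t u1 u2 K"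
      using QD[OF Q(2)] by (elim exE conjE)
    \<comment> \<open>The closed walk u1, w1, through W to w2, then u2, and back to u1 inside D.
      Since e1 and e2 are induced neither by W nor by Q, they do not cancel, and they are the only
      edges of \<open>?Z\<close> outside \<open>?I W \<union> D\<close>.\<close>
    let ?Z = "sym_diff (sym_diff (sym_diff {e1} J) {e2}) K"
    have "even_set s t ?Z"
      unfolding even_set_iff_join[of _ _ _ u1]
      by (rule join_sym_diff[OF join_sym_diff[OF join_sym_diff[OF 1(3) J(2)] join_commute[OF 2(3)]]
            join_commute[OF K(2)]])
    moreover have "?Z \<subseteq> E" using J(1) K(1) DE eE by auto
    moreover have "?Z - (?I W \<union> D \<union> Y) \<subseteq> {e1, e2}" using J(1) K(1) by auto
    moreover have "coverable E s t (?I W \<union> D \<union> Y \<union> ?Z)"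
      by (rule coverable_mono[OF X]) (use e J(1) K(1) D(1) enotin in blast)
    ultimately have "coverable E s t (?I W \<union> D \<union> Y)"
      by (metis coverable_remove_even_set)
    \<comment> \<open>The closure property of W is applied with \<open>D \<union> Y\<close> for Y;
      this is the reason why \<open>closed_part\<close> quantifies over Y.\<close>
    then show ?thesis
      using closure DE(1) Y by (simp add: Un_assoc)
  qed
  have "C \<inter> D = {}" using C(1) D(1) disj by (auto simp: induced_def)
  then have "C \<union> D = sym_diff C D" by blast
  then have "even_set s t (C \<union> D)" using even_set_sym_diff[OF C(2) D(2)] by simp
  moreover have "C \<union> D \<subseteq> ?I ?W'" using C(1) XI by blast
  moreover have "\<exists>J\<subseteq>?I ?W'. join s t x y J" if "x \<in> ?W'" "y \<in> ?W'" for x y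
    using joined[OF that] XI by blast
  ultimately have "closed_part ?W'"
    unfolding closed_part_def using WV LV Q(3) closure' by (intro conjI exI[of _ "C \<union> D"]) auto
  then show thesis using that[of ?W'] Q(1) disj by blast
qed

text \<open>A maximal closed part must be V. Its even set C, taken with empty Y, and the two sets
  witnessing \<open>coverable\<close> for C form the triple.\<close>

lemma even_cover_3_edge_connected:
  assumes cuts: "\<And>S. S \<subseteq> V \<Longrightarrow> S \<noteq> {} \<Longrightarrow> S \<noteq> V \<Longrightarrow> 3 \<le> card (E \<inter> edge_cut s t S)"
  shows "\<exists>A B C. even_set s t A \<and> even_set s t B \<and> even_set s t C \<and>
    A \<subseteq> E \<and> B \<subseteq> E \<and> C \<subseteq> E \<and> E \<subseteq> A \<union> B \<union> C"
proof (cases "V = {}")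
  case True
  then have "E = {}" using ends by blast
  then show ?thesis using even_set_empty by blast
next
  case False
  have "finite {W. closed_part W}"
    by (rule finite_subset[of _ "Pow V"]) (auto simp: closed_part_def finite_V)
  then obtain W where W: "closed_part W" "\<And>W'. closed_part W' \<Longrightarrow> W \<subseteq> W' \<Longrightarrow> W = W'"
    using finite_has_maximal[of "{W. closed_part W}"] closed_part_singleton False by blast
  have "W = V" using closed_part_extend[OF cuts W(1)] W(2) by blast
  then have "induced E s t W = E" using ends by (auto simp: induced_def)
  then obtain C where C: "C \<subseteq> E" "even_set s t C" and "coverable E s t E \<Longrightarrow> coverable E s t C"
    using W(1) unfolding closed_part_def by (metis Un_empty_right empty_subsetI)
  moreover have "coverable E s t E"
    using even_set_empty unfolding coverable_def by (intro exI[of _ "{}"]) auto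
  ultimately have "coverable E s t C" by blast
  then show ?thesis using C unfolding coverable_def by blast
qed

end

section \<open>Reduction to the 3-edge-connected case\<close>

text \<open>After contraction of e, parity is known only for cuts that keep the ends of e together.
  Putting e into C' exactly when f is in C makes the cut of S even as well, and any cut separating
  the ends of e is the sum of that one and a cut that does not. An edge e lost in the contraction is
  thus covered wherever f is.\<close>

lemma lift_even_set:
  assumes K: "E \<inter> edge_cut s t S = {e, f}" "e \<noteq> f" and C: "C \<subseteq> E" "finite C"
    and even: "\<And>S. (s e \<in> S \<longleftrightarrow> t e \<in> S) \<Longrightarrow> even (card (C \<inter> edge_cut s t S))"
  obtains C' where "even_set s t C'" "C' \<subseteq> E" "C - {e} \<subseteq> C'" "f \<in> C \<Longrightarrow> e \<in> C'"
proof
  define C' where "C' = (C - {e}) \<union> (if f \<in> C then {e} else {})"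
  show "C' \<subseteq> E" "C - {e} \<subseteq> C'" "f \<in> C \<Longrightarrow> e \<in> C'"
    using K C by (auto simp: C'_def)
  have finC': "finite C'" using C(2) by (simp add: C'_def)
  have parallel: "even (card (C' \<inter> edge_cut s t R))" if "s e \<in> R \<longleftrightarrow> t e \<in> R" for R
  proof -
    have "e \<notin> edge_cut s t R" using that by (simp add: edge_cut_def)
    then have "C' \<inter> edge_cut s t R = C \<inter> edge_cut s t R" by (auto simp: C'_def)
    then show ?thesis using even[OF that] by simp
  qed
  have "C' \<inter> edge_cut s t S = (if f \<in> C then {e, f} else {})"
    using K C(1) by (auto simp: C'_def)
  then have evenS: "even (card (C' \<inter> edge_cut s t S))" using K(2) by simp
  have eS: "(s e \<in> S) \<noteq> (t e \<in> S)" using K(1) by (auto simp: edge_cut_def)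
  have "even (card (C' \<inter> edge_cut s t R))" for R
  proof (cases "s e \<in> R \<longleftrightarrow> t e \<in> R")
    case False
    then have "even (card (C' \<inter> edge_cut s t (sym_diff S R)))"
      using eS by (intro parallel) blast
    moreover have "C' \<inter> edge_cut s t (sym_diff S R) = sym_diff (C' \<inter> edge_cut s t S) (C' \<inter> edge_cut s t R)"
      unfolding edge_cut_sym_diff by blast
    ultimately show ?thesis
      using even_card_sym_diff[of "C' \<inter> edge_cut s t S" "C' \<inter> edge_cut s t R"] finC' evenS by simp
  qed (rule parallel)
  then show "even_set s t C'" using finC' by (simp add: even_set_def)
qed

text \<open>Identifying the ends of an edge in a two-edge cut, or two vertices separated by an empty cut,
  preserves the parity conditions needed to lift an even cover back.\<close>

lemma even_cover_bridgeless:
  assumes "finite V" "finite E" "\<And>e. e \<in> E \<Longrightarrow> s e \<in> V \<and> t e \<in> V"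
    and "\<And>S. card (E \<inter> edge_cut s t S) \<noteq> 1"
  shows "\<exists>A B C. even_set s t A \<and> even_set s t B \<and> even_set s t C \<and>
    A \<subseteq> E \<and> B \<subseteq> E \<and> C \<subseteq> E \<and> E \<subseteq> A \<union> B \<union> C"
  using assms(1,3,4)
proof (induction "card V" arbitrary: V s t rule: less_induct)
  case less
  interpret multigraph V E s t
    by unfold_locales (use less.prems assms(2) in auto)
  show ?case
  proof (cases "\<forall>S. S \<subseteq> V \<longrightarrow> S \<noteq> {} \<longrightarrow> S \<noteq> V \<longrightarrow> 3 \<le> card (E \<inter> edge_cut s t S)")
    case True
    then show ?thesis by (intro even_cover_3_edge_connected) simp
  next
    case False
    then obtain S where S: "S \<subseteq> V" "S \<noteq> {}" "S \<noteq> V" "card (E \<inter> edge_cut s t S) < 3"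
      by (auto simp: not_le)
    have finC: "finite X" if "X \<subseteq> E" for X using that assms(2) by (rule finite_subset)
    have reduce: "\<exists>A B C. A \<subseteq> E \<and> B \<subseteq> E \<and> C \<subseteq> E \<and> E \<subseteq> A \<union> B \<union> C \<and>
        (\<forall>X\<in>{A, B, C}. \<forall>R. (x \<in> R \<longleftrightarrow> y \<in> R) \<longrightarrow> even (card (X \<inter> edge_cut s t R)))"
      if xy: "x \<in> V" "y \<in> V" "x \<noteq> y" for x y
    proof -
      define p where "p z = (if z = y then x else z)" for z
      have cut: "edge_cut (p \<circ> s) (p \<circ> t) R = edge_cut s t (p -` R)" for R
        by (auto simp: edge_cut_def)
      have "card (V - {y}) < card V" using xy finite_V by (meson card_Diff1_less)
      then have "\<exists>A B C. even_set (p \<circ> s) (p \<circ> t) A \<and> even_set (p \<circ> s) (p \<circ> t) B \<and>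
          even_set (p \<circ> s) (p \<circ> t) C \<and> A \<subseteq> E \<and> B \<subseteq> E \<and> C \<subseteq> E \<and> E \<subseteq> A \<union> B \<union> C"
      proof (rule less.hyps)
        show "finite (V - {y})" using finite_V by simp
        show "(p \<circ> s) e \<in> V - {y} \<and> (p \<circ> t) e \<in> V - {y}" if "e \<in> E" for e
          using ends[OF that] xy by (auto simp: p_def)
        show "card (E \<inter> edge_cut (p \<circ> s) (p \<circ> t) R) \<noteq> 1" for R
          unfolding cut by (rule less.prems(3))
      qed
      then obtain A B C where ABC: "even_set (p \<circ> s) (p \<circ> t) A" "even_set (p \<circ> s) (p \<circ> t) B"
          "even_set (p \<circ> s) (p \<circ> t) C" "A \<subseteq> E" "B \<subseteq> E" "C \<subseteq> E" "E \<subseteq> A \<union> B \<union> C"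
        by (elim exE conjE)
      have par: "even (card (X \<inter> edge_cut s t R))"
        if X: "even_set (p \<circ> s) (p \<circ> t) X" and R: "x \<in> R \<longleftrightarrow> y \<in> R" for X R
      proof -
        have "p -` R = R" using R by (auto simp: p_def split: if_splits)
        then show ?thesis using X unfolding even_set_def cut by metis
      qed
      show ?thesis
        by (rule exI[of _ A], rule exI[of _ B], rule exI[of _ C]) (use ABC par in auto)
    qed
    have "card (E \<inter> edge_cut s t S) = 0 \<or> card (E \<inter> edge_cut s t S) = 2"
      using S(4) less.prems(3)[of S] by linarith
    then show ?thesis
    proof
      assume "card (E \<inter> edge_cut s t S) = 0"
      then have empty: "E \<inter> edge_cut s t S = {}" using assms(2) by simp
      obtain x y where xy: "x \<in> S" "y \<in> V" "y \<notin> S" using S by blast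
      then have "x \<in> V" "x \<noteq> y" using S(1) by auto
      from reduce[OF this(1) xy(2) this(2)] obtain A B C where ABC: "A \<subseteq> E" "B \<subseteq> E" "C \<subseteq> E" "E \<subseteq> A \<union> B \<union> C"
        and even: "\<forall>X\<in>{A, B, C}. \<forall>R. (x \<in> R \<longleftrightarrow> y \<in> R) \<longrightarrow> even (card (X \<inter> edge_cut s t R))"
        by (elim exE conjE)
      have ev: "even_set s t X" if X: "X \<in> {A, B, C}" for X
        unfolding even_set_def
      proof (intro conjI allI)
        have XE: "X \<subseteq> E" using X ABC by blast
        then show "finite X" by (rule finC)
        fix R
        show "even (card (X \<inter> edge_cut s t R))"
        proof (cases "x \<in> R \<longleftrightarrow> y \<in> R")
          case False
          \<comment> \<open>S separates x from y at no cost in edges, so adding it turns a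
            separating R into one to which the induction applies.\<close>
          have "X \<inter> edge_cut s t (sym_diff S R) = X \<inter> edge_cut s t R"
            using empty XE unfolding edge_cut_sym_diff by blast
          moreover have "x \<in> sym_diff S R \<longleftrightarrow> y \<in> sym_diff S R"
            using False xy by blast
          ultimately show ?thesis using even X by metis
        qed (use even X in blast)
      qed
      show ?thesis
        by (rule exI[of _ A], rule exI[of _ B], rule exI[of _ C]) (use ABC ev in simp)
    next
      assume "card (E \<inter> edge_cut s t S) = 2"
      then obtain e f where K: "E \<inter> edge_cut s t S = {e, f}" "e \<noteq> f"
        by (meson card_2_iff)
      then have e: "e \<in> E" "f \<in> E" "e \<in> edge_cut s t S" by blast+
      then have ne: "s e \<noteq> t e" by (auto simp: edge_cut_def)
      have "s e \<in> V" "t e \<in> V" using ends[OF e(1)] by auto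
      from reduce[OF this ne] obtain A B C where
        ABC: "A \<subseteq> E" "B \<subseteq> E" "C \<subseteq> E" "E \<subseteq> A \<union> B \<union> C"
        and even: "\<forall>X\<in>{A, B, C}. \<forall>R. (s e \<in> R \<longleftrightarrow> t e \<in> R) \<longrightarrow> even (card (X \<inter> edge_cut s t R))"
        by (elim exE conjE)
      have lift: "\<exists>X'. even_set s t X' \<and> X' \<subseteq> E \<and> X - {e} \<subseteq> X' \<and> (f \<in> X \<longrightarrow> e \<in> X')"
        if X: "X \<in> {A, B, C}" for X
      proof -
        have XE: "X \<subseteq> E" using X ABC by blast
        have ev: "even (card (X \<inter> edge_cut s t R))" if "s e \<in> R \<longleftrightarrow> t e \<in> R" for R
          using even X that by blast
        show ?thesis
          by (rule lift_even_set[OF K XE finC[OF XE] ev]) auto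
      qed
      obtain A' where A': "even_set s t A'" "A' \<subseteq> E" "A - {e} \<subseteq> A'" "f \<in> A \<longrightarrow> e \<in> A'"
        using lift[of A, simplified] by (elim exE conjE)
      obtain B' where B': "even_set s t B'" "B' \<subseteq> E" "B - {e} \<subseteq> B'" "f \<in> B \<longrightarrow> e \<in> B'"
        using lift[of B, simplified] by (elim exE conjE)
      obtain C' where C': "even_set s t C'" "C' \<subseteq> E" "C - {e} \<subseteq> C'" "f \<in> C \<longrightarrow> e \<in> C'"
        using lift[of C, simplified] by (elim exE conjE)
      have "e \<in> A' \<union> B' \<union> C'" using ABC(4) e(2) A'(4) B'(4) C'(4) by blast
      then have "E \<subseteq> A' \<union> B' \<union> C'" using ABC(4) A'(3) B'(3) C'(3) by blast
      then show ?thesis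
        using A'(1,2) B'(1,2) C'(1,2) by (intro exI conjI)
    qed
  qed
qed

text \<open>An edge that is alone in some cut can lie in no even subset of E. Such edges are deleted
  one by one until \<open>even_cover_bridgeless\<close> applies.\<close>

lemma even_cover_non_bridges:
  assumes "finite V" "finite E" "\<And>e. e \<in> E \<Longrightarrow> s e \<in> V \<and> t e \<in> V"
  shows "\<exists>A B C. even_set s t A \<and> even_set s t B \<and> even_set s t C \<and>
    A \<subseteq> E \<and> B \<subseteq> E \<and> C \<subseteq> E \<and> (\<forall>e\<in>E. (\<exists>S. E \<inter> edge_cut s t S = {e}) \<or> e \<in> A \<union> B \<union> C)"
  using assms(2,3)
proof (induction "card E" arbitrary: E rule: less_induct)
  case less
  show ?case
  proof (cases "\<forall>S. card (E \<inter> edge_cut s t S) \<noteq> 1")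
    case True
    then have "\<exists>A B C. even_set s t A \<and> even_set s t B \<and> even_set s t C \<and>
      A \<subseteq> E \<and> B \<subseteq> E \<and> C \<subseteq> E \<and> E \<subseteq> A \<union> B \<union> C"
      by (intro even_cover_bridgeless[OF assms(1) less.prems]) simp_all
    then obtain A B C where ABC: "even_set s t A" "even_set s t B" "even_set s t C"
        "A \<subseteq> E" "B \<subseteq> E" "C \<subseteq> E" and "E \<subseteq> A \<union> B \<union> C"
      by (elim exE conjE)
    then have "\<forall>e\<in>E. (\<exists>S. E \<inter> edge_cut s t S = {e}) \<or> e \<in> A \<union> B \<union> C" by blast
    then show ?thesis using ABC by (intro exI conjI)
  next
    case False
    then obtain S e where S: "E \<inter> edge_cut s t S = {e}" by (auto simp: card_1_singleton_iff)
    have "card (E - {e}) < card E" using S less.prems(1) by (intro card_Diff1_less) auto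
    then have "\<exists>A B C. even_set s t A \<and> even_set s t B \<and> even_set s t C \<and>
      A \<subseteq> E - {e} \<and> B \<subseteq> E - {e} \<and> C \<subseteq> E - {e} \<and>
      (\<forall>e'\<in>E - {e}. (\<exists>S. (E - {e}) \<inter> edge_cut s t S = {e'}) \<or> e' \<in> A \<union> B \<union> C)"
      by (rule less.hyps) (use less.prems in auto)
    then obtain A B C where ABC: "even_set s t A" "even_set s t B" "even_set s t C"
        "A \<subseteq> E - {e}" "B \<subseteq> E - {e}" "C \<subseteq> E - {e}"
      and cover: "\<forall>e'\<in>E - {e}. (\<exists>S. (E - {e}) \<inter> edge_cut s t S = {e'}) \<or> e' \<in> A \<union> B \<union> C"
      by (elim exE conjE)
    have cover': "(\<exists>S. E \<inter> edge_cut s t S = {e'}) \<or> e' \<in> A \<union> B \<union> C" if e': "e' \<in> E" for e'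
    proof (cases "e' = e")
      case True
      then show ?thesis using S by blast
    next
      case False
      then have "(\<exists>S. (E - {e}) \<inter> edge_cut s t S = {e'}) \<or> e' \<in> A \<union> B \<union> C"
        using cover e' by simp
      then show ?thesis
      proof
        assume "\<exists>S. (E - {e}) \<inter> edge_cut s t S = {e'}"
        then obtain R where R: "(E - {e}) \<inter> edge_cut s t R = {e'}" by (elim exE)
        show ?thesis
        proof (cases "e \<in> edge_cut s t R")
          case True
          then have inR: "d \<in> edge_cut s t R \<longleftrightarrow> d = e \<or> d = e'" if "d \<in> E" for d
            using R that by (cases "d = e") auto
          have inS: "d \<in> edge_cut s t S \<longleftrightarrow> d = e" if "d \<in> E" for d
            using S that by auto
          \<comment> \<open>The cut of R contains the deleted edge e besides e'. Adding the cut of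
            S, whose only edge is e, cancels e, so e' was a bridge before the deletion too.\<close>
          have "E \<inter> edge_cut s t (sym_diff S R) = {e'}"
            unfolding edge_cut_sym_diff using inR inS e' \<open>e' \<noteq> e\<close> by auto
          then show ?thesis by (intro disjI1 exI)
        next
          case False
          then have "E \<inter> edge_cut s t R = {e'}" using R S by blast
          then show ?thesis by (intro disjI1 exI)
        qed
      qed simp
    qed
    show ?thesis
      by (rule exI[of _ A], rule exI[of _ B], rule exI[of _ C]) (use ABC cover' in blast)
  qed
qed

section \<open>Reachability\<close>

lemma reach_induct_invariant:
  assumes "reach F u v" and "\<And>x y. {x, y} \<in> F \<Longrightarrow> g x = g y"
  shows "g u = g v"
  using assms(1) unfolding reach_def
  by (induction rule: rtrancl_induct) (use assms(2) in auto)

lemma reach_refl: "reach F u u"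
  by (simp add: reach_def)

lemma reach_edge: "{u, v} \<in> F \<Longrightarrow> reach F u v"
  by (auto simp: reach_def)

lemma reach_trans: "reach F u v \<Longrightarrow> reach F v w \<Longrightarrow> reach F u w"
  unfolding reach_def by (rule rtrancl_trans)

lemma reach_sym: "reach F u v \<Longrightarrow> reach F v u"
proof -
  have "sym {(x, y). {x, y} \<in> F}"
    by (auto simp: sym_def insert_commute)
  then show "reach F u v \<Longrightarrow> reach F v u"
    unfolding reach_def by (meson sym_rtrancl symD)
qed

lemma reach_mono: "reach F u v \<Longrightarrow> F \<subseteq> F' \<Longrightarrow> reach F' u v"
  unfolding reach_def by (erule rtrancl_mono[THEN subsetD, rotated]) auto

lemma reach_crossing:
  assumes "reach F u v" "u \<in> S" "v \<notin> S"
  obtains x y where "{x, y} \<in> F" "x \<in> S" "y \<notin> S" "reach F u x"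
proof -
  have "v \<in> S \<or> (\<exists>x y. {x, y} \<in> F \<and> x \<in> S \<and> y \<notin> S \<and> reach F u x)"
    using assms(1) unfolding reach_def
    by (induction rule: rtrancl_induct) (use assms(2) in auto)
  then show thesis using that assms(3) by blast
qed

section \<open>Star arboricity of graphs without a complete minor\<close>

text \<open>The vertices of A are leaves, each with the single possible edge to its centre
  \<open>p v\<close> outside A.\<close>

lemma star_forestI:
  fixes p :: "'a \<Rightarrow> 'a" and A :: "'a set"
  assumes F: "\<And>e. e \<in> F \<Longrightarrow> \<exists>v. e = {v, p v} \<and> v \<in> A \<and> p v \<notin> A"
  shows "star_forest F"
proof -
  \<comment> \<open>The centre of the star containing x; it is constant along edges, so connected
    vertices share it.\<close>
  define \<kappa> where "\<kappa> x = (if x \<in> A then p x else x)" for x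
  have \<kappa>: "\<kappa> x = \<kappa> y" if xy: "{x, y} \<in> F" for x y
  proof -
    obtain v where "{x, y} = {v, p v}" "v \<in> A" "p v \<notin> A"
      using F[OF xy] by blast
    then show ?thesis by (auto simp: doubleton_eq_iff \<kappa>_def)
  qed
  have leaf: "{x, p x} \<in> F" if xy: "reach F x y" "x \<noteq> y" "x \<in> A" for x y
  proof -
    obtain z where z: "{x, z} \<in> F"
      using reach_crossing[OF xy(1), of "{x}"] xy(2) by blast
    obtain v where "{x, z} = {v, p v}" "v \<in> A" "p v \<notin> A"
      using F[OF z] by blast
    then show ?thesis using z xy(3) by (auto simp: doubleton_eq_iff)
  qed
  have "\<not> reach (F - {{u, v}}) u v" if uv: "{u, v} \<in> F" for u v
  proof
    assume r: "reach (F - {{u, v}}) u v"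
    have star: "\<not> reach (F - {{x, p x}}) x y" if xy: "x \<in> A" "x \<noteq> y" for x y
    proof
      assume "reach (F - {{x, p x}}) x y"
      then obtain z where z: "{x, z} \<in> F - {{x, p x}}"
        using reach_crossing[of _ x y "{x}"] xy(2) by blast
      then obtain v where "{x, z} = {v, p v}" "v \<in> A" "p v \<notin> A"
        using F by blast
      then show False using z xy(1) by (auto simp: doubleton_eq_iff)
    qed
    obtain w where "{u, v} = {w, p w}" "w \<in> A" "p w \<notin> A"
      using F[OF uv] by blast
    moreover from this have "w \<noteq> p w" by auto
    ultimately show False
      using star[of u v] star[of v u] r reach_sym[OF r]
      by (auto simp: doubleton_eq_iff insert_commute)
  qed
  moreover have "u = v \<or> {u, v} \<in> F \<or> (\<exists>w. {u, w} \<in> F \<and> {w, v} \<in> F)" if uv: "reach F u v" for u v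
  proof (cases "u = v")
    case False
    have eq: "\<kappa> u = \<kappa> v" using reach_induct_invariant[OF uv] \<kappa> by blast
    have vu: "reach F v u" using reach_sym uv .
    show ?thesis
      using eq False leaf[OF uv False] leaf[OF vu] unfolding \<kappa>_def
      by (metis insert_commute)
  qed simp
  ultimately show ?thesis unfolding star_forest_def forest_def by blast
qed

definition neighbours :: "'a set set \<Rightarrow> 'a \<Rightarrow> 'a set" where
  "neighbours E v = {u. {u, v} \<in> E}"

text \<open>Repeatedly removing a vertex v of degree at most d, v points to its remaining neighbours
  under distinct indices i < d. For each i the pointers form a rooted forest, since they go to
  vertices removed later, and \<open>\<chi> i\<close> is a proper 2-colouring of it.\<close>

lemma degenerate_orientation:
  assumes "finite V"
    and "\<And>U. U \<subseteq> V \<Longrightarrow> U \<noteq> {} \<Longrightarrow> \<exists>v\<in>U. card (neighbours E v \<inter> U) \<le> d"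
    and "\<And>e. e \<in> E \<Longrightarrow> \<exists>u v. e = {u, v} \<and> u \<noteq> v"
  shows "\<exists>(p :: nat \<Rightarrow> 'a \<Rightarrow> 'a option) \<chi> :: nat \<Rightarrow> 'a \<Rightarrow> bool.
    (\<forall>i v u. p i v = Some u \<longrightarrow> u \<in> V \<and> v \<in> V \<and> \<chi> i u \<noteq> \<chi> i v) \<and>
    (\<forall>e\<in>E. e \<subseteq> V \<longrightarrow> (\<exists>i<d. \<exists>v u. p i v = Some u \<and> e = {v, u}))"
  using assms(1,2)
proof (induction "card V" arbitrary: V rule: less_induct)
  case less
  show ?case
  proof (cases "V = {}")
    case True
    have "\<not> e \<subseteq> {}" if "e \<in> E" for e
      using assms(3)[OF that] by auto
    then show ?thesis
      unfolding True by (intro exI[of _ "\<lambda>_ _. None"] exI[of _ "\<lambda>_ _. True"]) simp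
  next
    case False
    obtain v where v: "v \<in> V" "card (neighbours E v \<inter> V) \<le> d"
      using less.prems(2)[OF subset_refl False] by blast
    define N where "N = neighbours E v \<inter> V"
    have finN: "finite N" using less.prems(1) by (simp add: N_def)
    have vN: "v \<notin> N"
    proof
      assume "v \<in> N"
      then have "{v} \<in> E" by (simp add: N_def neighbours_def)
      from assms(3)[OF this] show False by (auto simp: doubleton_eq_iff)
    qed
    obtain h where h: "bij_betw h {0..<card N} N"
      using ex_bij_betw_nat_finite[OF finN] by blast
    have "card (V - {v}) < card V"
      using v less.prems(1) by (meson card_Diff1_less)
    then have "\<exists>(p :: nat \<Rightarrow> 'a \<Rightarrow> 'a option) \<chi> :: nat \<Rightarrow> 'a \<Rightarrow> bool.
        (\<forall>i x u. p i x = Some u \<longrightarrow> u \<in> V - {v} \<and> x \<in> V - {v} \<and> \<chi> i u \<noteq> \<chi> i x) \<and>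
        (\<forall>e\<in>E. e \<subseteq> V - {v} \<longrightarrow> (\<exists>i<d. \<exists>x u. p i x = Some u \<and> e = {x, u}))"
      by (rule less.hyps) (use less.prems in auto)
    then obtain p :: "nat \<Rightarrow> 'a \<Rightarrow> 'a option" and \<chi> :: "nat \<Rightarrow> 'a \<Rightarrow> bool" where
        p': "\<forall>i x u. p i x = Some u \<longrightarrow> u \<in> V - {v} \<and> x \<in> V - {v} \<and> \<chi> i u \<noteq> \<chi> i x"
      and cover: "\<forall>e\<in>E. e \<subseteq> V - {v} \<longrightarrow> (\<exists>i<d. \<exists>x u. p i x = Some u \<and> e = {x, u})"
      by (elim exE conjE) (rule that; assumption)
    have p: "u \<in> V - {v} \<and> x \<in> V - {v} \<and> \<chi> i u \<noteq> \<chi> i x" if "p i x = Some u" for i x u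
      using p' that by blast
    define p' where "p' i = (p i)(v := if i < card N then Some (h i) else None)" for i
    \<comment> \<open>Recolouring v is safe because the old pointers stay inside
      \<open>V - {v}\<close>; this is why membership in V is part of the claim. For
      \<open>i \<ge> card N\<close> the value \<open>h i\<close> is arbitrary, but v then has no
      pointer.\<close>
    define \<chi>' where "\<chi>' i = (\<chi> i)(v := \<not> \<chi> i (h i))" for i
    have hN: "h i \<in> N" if "i < card N" for i
      using h that by (auto simp: bij_betw_def)
    show ?thesis
    proof (rule exI[of _ p'], rule exI[of _ \<chi>'], intro conjI allI impI ballI)
      fix i x u assume pu: "p' i x = Some u"
      have "u \<in> V \<and> x \<in> V \<and> \<chi>' i u \<noteq> \<chi>' i x"
      proof (cases "x = v")
        case True
        then have "i < card N" "u = h i" using pu by (auto simp: p'_def split: if_splits)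
        then show ?thesis
          using hN[of i] vN v(1) True by (auto simp: \<chi>'_def N_def)
      next
        case False
        then have "p i x = Some u" using pu by (simp add: p'_def)
        from p[OF this] show ?thesis using False by (auto simp: \<chi>'_def)
      qed
      then show "u \<in> V" "x \<in> V" "\<chi>' i u \<noteq> \<chi>' i x" by auto
    next
      fix e assume e: "e \<in> E" "e \<subseteq> V"
      show "\<exists>i<d. \<exists>x u. p' i x = Some u \<and> e = {x, u}"
      proof (cases "v \<in> e")
        case True
        then obtain u where u: "e = {u, v}"
          using assms(3)[OF e(1)] by (auto simp: insert_commute)
        then have "u \<in> N" using e by (auto simp: N_def neighbours_def)
        then obtain i where i: "i < card N" "h i = u"
          using h unfolding bij_betw_def by (metis atLeastLessThan_iff imageE)
        then have "i < d" "p' i v = Some u" "e = {v, u}"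
          using u v(2) by (auto simp: p'_def N_def)
        then show ?thesis by metis
      next
        case False
        then have "e \<subseteq> V - {v}" using e(2) by blast
        then obtain i x u where ixu: "i < d" "p i x = Some u" "e = {x, u}"
          using bspec[OF cover e(1)] by (elim impE exE conjE) auto
        then have "x \<noteq> v" using False by auto
        then show ?thesis using ixu by (auto simp: p'_def)
      qed
    qed
  qed
qed

text \<open>Each of the d pointer forests splits by the colour of the tail: in one class all tails
  have one colour and all heads the other, so no head is a tail. The class number is twice the index
  plus the tail's colour bit.\<close>

lemma star_arboricity_le_degenerate:
  assumes "graph V E"
    and "\<And>U. U \<subseteq> V \<Longrightarrow> U \<noteq> {} \<Longrightarrow> \<exists>v\<in>U. card (neighbours E v \<inter> U) \<le> d"
  shows "star_arboricity E \<le> 2 * d"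
proof -
  have fin: "finite V" using assms(1) by (simp add: graph_def)
  have E: "\<exists>u v. e = {u, v} \<and> u \<noteq> v" "e \<subseteq> V" if "e \<in> E" for e
    using assms(1) that unfolding graph_def by (blast, fastforce)
  obtain p :: "nat \<Rightarrow> 'a \<Rightarrow> 'a option" and \<chi> :: "nat \<Rightarrow> 'a \<Rightarrow> bool" where
      p: "\<And>i v u. p i v = Some u \<Longrightarrow> \<chi> i u \<noteq> \<chi> i v"
    and cover: "\<And>e. e \<in> E \<Longrightarrow> \<exists>i<d. \<exists>v u. p i v = Some u \<and> e = {v, u}"
    using degenerate_orientation[OF fin assms(2) E(1)] E(2) by metis
  have "\<exists>i v. i < d \<and> p i v \<noteq> None \<and> e = {v, the (p i v)}" if "e \<in> E" for e
    using cover[OF that] by fastforce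
  then obtain ix tl where
    ix: "\<And>e. e \<in> E \<Longrightarrow> ix e < d \<and> p (ix e) (tl e) \<noteq> None \<and> e = {tl e, the (p (ix e) (tl e))}"
    by metis
  define c where "c e = 2 * ix e + of_bool (\<chi> (ix e) (tl e))" for e
  have "c e < 2 * d" if "e \<in> E" for e
    using ix[OF that] by (auto simp: c_def)
  moreover have "star_forest {e\<in>E. c e = j}" for j
  proof (rule star_forestI[where p = "\<lambda>v. the (p (j div 2) v)" and A = "{v. \<chi> (j div 2) v = odd j}"])
    fix e assume "e \<in> {e\<in>E. c e = j}"
    then have e: "e \<in> E" "c e = j" by auto
    have j: "j div 2 = ix e" "odd j = \<chi> (ix e) (tl e)"
      using e(2) by (auto simp: c_def)
    show "\<exists>v. e = {v, the (p (j div 2) v)} \<and> v \<in> {v. \<chi> (j div 2) v = odd j}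
        \<and> the (p (j div 2) v) \<notin> {v. \<chi> (j div 2) v = odd j}"
      unfolding j using ix[OF e(1)] p[of "ix e" "tl e"] by (intro exI[of _ "tl e"]) auto
  qed
  ultimately show ?thesis
    unfolding star_arboricity_def by (intro Least_le) blast
qed

section \<open>Mader's edge-density bound\<close>

lemma sum_degrees:
  assumes "finite U" "\<And>e. e \<in> E \<Longrightarrow> \<exists>u v. e = {u, v} \<and> u \<noteq> v"
  shows "(\<Sum>v\<in>U. card (neighbours E v \<inter> U)) = 2 * card {e\<in>E. e \<subseteq> U}"
proof -
  have finE: "finite {e\<in>E. e \<subseteq> U}"
    by (rule finite_subset[of _ "Pow U"]) (use assms(1) in auto)
  have deg: "card (neighbours E v \<inter> U) = card {e\<in>{e\<in>E. e \<subseteq> U}. v \<in> e}" if "v \<in> U" for v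
  proof (rule bij_betw_same_card)
    show "bij_betw (\<lambda>u. {u, v}) (neighbours E v \<inter> U) {e\<in>{e\<in>E. e \<subseteq> U}. v \<in> e}"
      unfolding bij_betw_def
    proof
      show "inj_on (\<lambda>u. {u, v}) (neighbours E v \<inter> U)"
        by (auto simp: inj_on_def doubleton_eq_iff)
      show "(\<lambda>u. {u, v}) ` (neighbours E v \<inter> U) = {e\<in>{e\<in>E. e \<subseteq> U}. v \<in> e}"
      proof (intro equalityI subsetI)
        fix e assume e: "e \<in> {e\<in>{e\<in>E. e \<subseteq> U}. v \<in> e}"
        then obtain u where "e = {u, v}"
          using assms(2)[of e] by (auto simp: insert_commute)
        then show "e \<in> (\<lambda>u. {u, v}) ` (neighbours E v \<inter> U)"
          using e by (auto simp: neighbours_def)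
      qed (use that in \<open>auto simp: neighbours_def\<close>)
    qed
  qed
  have "(\<Sum>v\<in>U. card (neighbours E v \<inter> U)) = (\<Sum>v\<in>U. card {e\<in>{e\<in>E. e \<subseteq> U}. v \<in> e})"
    using deg by (rule sum.cong[OF refl])
  also have "\<dots> = (\<Sum>e\<in>{e\<in>E. e \<subseteq> U}. card {v\<in>U. v \<in> e})"
    using sum.swap_restrict[OF assms(1) finE, of "\<lambda>_ _. 1::nat" "\<lambda>v e. v \<in> e"]
    by (simp only: card_eq_sum)
  also have "\<dots> = (\<Sum>e\<in>{e\<in>E. e \<subseteq> U}. 2)"
  proof (rule sum.cong[OF refl])
    fix e assume e: "e \<in> {e\<in>E. e \<subseteq> U}"
    then obtain u v where "e = {u, v}" "u \<noteq> v" using assms(2) by blast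
    moreover from this have "{v\<in>U. v \<in> e} = {u, v}" using e by auto
    ultimately show "card {v\<in>U. v \<in> e} = 2" by simp
  qed
  finally show ?thesis by simp
qed

lemma card_edges_remove:
  assumes "finite U" "y \<in> U" "\<And>e. e \<in> E \<Longrightarrow> \<exists>u v. e = {u, v} \<and> u \<noteq> v"
  shows "card {e\<in>E. e \<subseteq> U} = card {e\<in>E. e \<subseteq> U - {y}} + card (neighbours E y \<inter> U)"
proof -
  have fin: "finite {e\<in>E. e \<subseteq> U}"
    by (rule finite_subset[of _ "Pow U"]) (use assms(1) in auto)
  have "{e\<in>E. e \<subseteq> U} = {e\<in>E. e \<subseteq> U - {y}} \<union> (\<lambda>u. {u, y}) ` (neighbours E y \<inter> U)"
  proof (intro equalityI subsetI)
    fix e assume e: "e \<in> {e\<in>E. e \<subseteq> U}"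
    show "e \<in> {e\<in>E. e \<subseteq> U - {y}} \<union> (\<lambda>u. {u, y}) ` (neighbours E y \<inter> U)"
    proof (cases "y \<in> e")
      case True
      then obtain u where "e = {u, y}"
        using assms(3)[of e] e by (auto simp: insert_commute)
      then show ?thesis using e by (auto simp: neighbours_def)
    qed (use e in auto)
  qed (use assms(2) in \<open>auto simp: neighbours_def\<close>)
  moreover have "card ((\<lambda>u. {u, y}) ` (neighbours E y \<inter> U)) = card (neighbours E y \<inter> U)"
    by (rule card_image) (auto simp: inj_on_def doubleton_eq_iff)
  ultimately show ?thesis
    using fin by (simp add: card_Un_disjoint) (subst card_Un_disjoint, auto)
qed

lemma connected_set_insert:
  assumes "connected_set E X" "x \<in> X" "{x, y} \<in> E"
  shows "connected_set E (insert y X)"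
proof -
  have X: "reach {e\<in>E. e \<subseteq> insert y X} u v" if "u \<in> X" "v \<in> X" for u v
    using assms(1) that unfolding connected_set_def by (blast intro: reach_mono)
  have xy: "reach {e\<in>E. e \<subseteq> insert y X} x y"
    using assms(2,3) by (intro reach_edge) auto
  have to_x: "reach {e\<in>E. e \<subseteq> insert y X} x u" if "u \<in> insert y X" for u
    using that xy X[OF assms(2)] by auto
  show ?thesis
    unfolding connected_set_def using to_x by (blast intro: reach_trans reach_sym)
qed

text \<open>Mader's argument: in a vertex-minimal counterexample to the edge bound, contract a maximal
  connected set \<open>X\<close> that preserves the edge density. By maximality, every neighbour of \<open>X\<close>
  has at least \<open>2 ^ s\<close> neighbours among the neighbours of \<open>X\<close>, so induction
  applies there and \<open>X\<close> is the additional branch set.\<close>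

lemma dense_has_K_minor:
  assumes "finite V" "V \<noteq> {}" "\<And>e. e \<in> E \<Longrightarrow> \<exists>u v. e = {u, v} \<and> u \<noteq> v"
    and "2 ^ s * card V \<le> card {e\<in>E. e \<subseteq> V}"
  shows "has_K_minor V E s"
  using assms(1,2,4)
proof (induction s arbitrary: V)
  case 0
  then show ?case by (simp add: has_K_minor_def)
next
  case (Suc s)
  define c :: nat where "c = 2 ^ Suc s"
  define ed where "ed U = card {e\<in>E. e \<subseteq> U}" for U
  define dense where "dense U \<longleftrightarrow> U \<subseteq> V \<and> U \<noteq> {} \<and> c * card U \<le> ed U" for U
  have "dense V" using Suc.prems by (simp add: dense_def c_def ed_def)
  moreover have "finite {U. dense U}"
    by (rule finite_subset[of _ "Pow V"]) (auto simp: dense_def Suc.prems)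
  ultimately obtain U where U: "dense U" and minU: "\<And>U'. dense U' \<Longrightarrow> U' \<subseteq> U \<Longrightarrow> U = U'"
    using finite_has_minimal[of "{U. dense U}"] by blast
  have finU: "finite U" using U Suc.prems(1) by (auto simp: dense_def finite_subset)
  define N where "N X = {y\<in>U - X. \<exists>x\<in>X. {x, y} \<in> E}" for X
  \<comment> \<open>After contracting X in the graph induced by U and dropping parallel edges,
    \<open>card (U - X) + 1\<close> counts the vertices and \<open>ed (U - X) + card (N X)\<close>
    the edges.\<close>
  define Q where "Q X \<longleftrightarrow> X \<subseteq> U \<and> connected_set E X \<and> c * (card (U - X) + 1) \<le> ed (U - X) + card (N X)" for X
  obtain x where x: "x \<in> U" using U by (auto simp: dense_def)
  have Nx: "neighbours E x \<inter> U = N {x}"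
  proof -
    have "{x} \<notin> E" using assms(3)[of "{x}"] by (auto simp: doubleton_eq_iff)
    then show ?thesis by (auto simp: N_def neighbours_def insert_commute)
  qed
  have "Q {x}"
  proof -
    have "card (U - {x}) + 1 = card U" using x finU by (metis Suc_eq_plus1 card_Suc_Diff1)
    moreover have "ed U = ed (U - {x}) + card (N {x})"
      using card_edges_remove[OF finU x assms(3)] Nx by (simp add: ed_def)
    ultimately show ?thesis
      using U x by (simp add: Q_def dense_def connected_set_def reach_refl)
  qed
  moreover have "finite {X. Q X}"
    by (rule finite_subset[of _ "Pow U"]) (auto simp: Q_def finU)
  ultimately obtain X where X: "Q X" and maxX: "\<And>X'. Q X' \<Longrightarrow> X \<subseteq> X' \<Longrightarrow> X = X'"
    using finite_has_maximal[of "{X. Q X}"] by blast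
  have conX: "connected_set E X" and XU: "X \<subseteq> U" and Xne: "X \<noteq> {}"
    using X by (auto simp: Q_def connected_set_def)
  have finN: "finite (N X)" using finU by (simp add: N_def)
  \<comment> \<open>Otherwise X contracts to an isolated vertex and \<open>U - X\<close> alone is
    dense enough, against minimality of U.\<close>
  have "N X \<noteq> {}"
  proof
    assume "N X = {}"
    then have le: "c * (card (U - X) + 1) \<le> ed (U - X)" using X by (simp add: Q_def)
    show False
    proof (cases "U - X = {}")
      case True
      have "{e\<in>E. e \<subseteq> {}} = {}" using assms(3) by fastforce
      then have "ed (U - X) = 0" unfolding ed_def True by simp
      then show False using le by (simp add: c_def)
    next
      case False
      then have "dense (U - X)" using le U by (auto simp: dense_def)
      then show False using minU[of "U - X"] Xne XU by blast
    qed
  qed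
  \<comment> \<open>Contracting y into X loses one vertex and one edge plus one for each common
    neighbour. As this destroys the density, more than c edges are lost, so there are at least c
    common neighbours.\<close>
  have deg: "c \<le> card (neighbours E y \<inter> N X)" if y: "y \<in> N X" for y
  proof -
    obtain z where z: "z \<in> X" "{z, y} \<in> E" and yU: "y \<in> U" "y \<notin> X"
      using y by (auto simp: N_def)
    have "\<not> Q (insert y X)" using maxX[of "insert y X"] yU by blast
    moreover have "connected_set E (insert y X)"
      using connected_set_insert[OF conX z] .
    ultimately have less: "ed (U - insert y X) + card (N (insert y X)) < c * (card (U - insert y X) + 1)"
      using yU XU by (simp add: Q_def)
    let ?M = "neighbours E y \<inter> (U - X)"
    have finM: "finite ?M" using finU by simp
    have UX: "U - insert y X = U - X - {y}" by blast
    have card_UX: "card (U - insert y X) + 1 = card (U - X)"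
      unfolding UX using yU finU by (metis DiffI Suc_eq_plus1 card_Suc_Diff1 finite_Diff)
    have ed_UX: "ed (U - X) = ed (U - insert y X) + card ?M"
      unfolding UX ed_def using card_edges_remove[of "U - X" y E] finU yU assms(3) by simp
    have yM: "y \<notin> ?M"
      using assms(3)[of "{y}"] by (auto simp: neighbours_def doubleton_eq_iff)
    have N': "N (insert y X) = (N X - {y}) \<union> ?M"
    proof -
      have "{y} \<notin> E" using assms(3)[of "{y}"] by (auto simp: doubleton_eq_iff)
      then show ?thesis by (auto simp: N_def neighbours_def insert_commute)
    qed
    have "(N X - {y}) \<inter> ?M = neighbours E y \<inter> N X"
      using yM by (auto simp: N_def)
    then have "card (N X - {y}) + card ?M = card (N (insert y X)) + card (neighbours E y \<inter> N X)"
      unfolding N' using card_Un_Int[of "N X - {y}" ?M] finN finM by simp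
    moreover have "card (N X - {y}) + 1 = card (N X)"
      using y finN by (metis Suc_eq_plus1 card_Suc_Diff1)
    moreover have "c * card (U - X) + c \<le> ed (U - X) + card (N X)"
      using X by (simp add: Q_def)
    moreover have "ed (U - insert y X) + card (N (insert y X)) < c * card (U - X)"
      using less unfolding card_UX .
    ultimately show ?thesis using ed_UX by linarith
  qed
  have "c * card (N X) \<le> (\<Sum>v\<in>N X. card (neighbours E v \<inter> N X))"
    using sum_mono[of "N X" "\<lambda>_. c"] deg by (simp add: mult.commute)
  also have "\<dots> = 2 * card {e\<in>E. e \<subseteq> N X}"
    by (rule sum_degrees[OF finN assms(3)])
  finally have "2 ^ s * card (N X) \<le> card {e\<in>E. e \<subseteq> N X}" by (simp add: c_def)
  then have "has_K_minor (N X) E s"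
    using Suc.IH finN \<open>N X \<noteq> {}\<close> by blast
  then obtain B where B': "\<forall>i<s. B i \<subseteq> N X \<and> connected_set E (B i)"
    and BB': "\<forall>i<s. \<forall>j<s. i \<noteq> j \<longrightarrow>
      B i \<inter> B j = {} \<and> (\<exists>u\<in>B i. \<exists>v\<in>B j. {u, v} \<in> E)"
    unfolding has_K_minor_def by (elim exE conjE)
  have B: "B i \<subseteq> N X" "connected_set E (B i)" if "i < s" for i
    using B' that by blast+
  have BB: "B i \<inter> B j = {} \<and> (\<exists>u\<in>B i. \<exists>v\<in>B j. {u, v} \<in> E)"
    if "i < s" "j < s" "i \<noteq> j" for i j
    using BB' that by blast
  have BX: "B i \<inter> X = {}" "\<exists>u\<in>B i. \<exists>v\<in>X. {u, v} \<in> E" "\<exists>v\<in>X. \<exists>u\<in>B i. {v, u} \<in> E" if i: "i < s" for i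
  proof -
    show "B i \<inter> X = {}" using B[OF i] by (auto simp: N_def)
    obtain u where u: "u \<in> B i" using B(2)[OF i] unfolding connected_set_def by blast
    then have "u \<in> N X" using B(1)[OF i] by (rule subsetD[rotated])
    then obtain v where v: "v \<in> X" "{v, u} \<in> E" by (auto simp: N_def)
    with u show "\<exists>v\<in>X. \<exists>u\<in>B i. {v, u} \<in> E" by (intro bexI[of _ v] bexI[of _ u])
    from v have "{u, v} \<in> E" by (simp add: insert_commute)
    with u v(1) show "\<exists>u\<in>B i. \<exists>v\<in>X. {u, v} \<in> E" by (intro bexI[of _ u] bexI[of _ v])
  qed
  have UV: "U \<subseteq> V" using U by (simp add: dense_def)
  show ?case
    unfolding has_K_minor_def
  proof (rule exI[of _ "B(s := X)"], intro conjI allI impI)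
    fix i assume "i < Suc s"
    then show "(B(s := X)) i \<subseteq> V" "connected_set E ((B(s := X)) i)"
      using B[of i] conX XU UV by (auto simp: N_def less_Suc_eq)
  next
    fix i j assume ij: "i < Suc s" "j < Suc s" "i \<noteq> j"
    then consider "i < s" "j < s" | "i = s" "j < s" | "i < s" "j = s"
      by linarith
    then have "(B(s := X)) i \<inter> (B(s := X)) j = {} \<and>
        (\<exists>u\<in>(B(s := X)) i. \<exists>v\<in>(B(s := X)) j. {u, v} \<in> E)"
    proof cases
      case 1
      then show ?thesis using BB[of i j] ij(3) by simp
    next
      case 2
      then show ?thesis using BX(1)[of j] BX(3)[of j] by (simp add: Int_commute)
    next
      case 3
      then show ?thesis using BX(1,2)[of i] by simp
    qed
    then show "(B(s := X)) i \<inter> (B(s := X)) j = {}"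
      "\<exists>u\<in>(B(s := X)) i. \<exists>v\<in>(B(s := X)) j. {u, v} \<in> E"
      by blast+
  qed
qed

lemma has_K_minor_mono:
  assumes "has_K_minor U E t" "U \<subseteq> V" "s \<le> t"
  shows "has_K_minor V E s"
proof -
  obtain B where "\<forall>i<t. B i \<subseteq> U \<and> connected_set E (B i)"
    "\<forall>i<t. \<forall>j<t. i \<noteq> j \<longrightarrow> B i \<inter> B j = {} \<and> (\<exists>u\<in>B i. \<exists>v\<in>B j. {u, v} \<in> E)"
    using assms(1) unfolding has_K_minor_def by blast
  then show ?thesis
    unfolding has_K_minor_def using assms(2,3) by (intro exI[of _ B]) (meson order.strict_trans2 subset_trans)
qed

text \<open>If all degrees inside some U exceeded \<open>2 * 2 ^ s\<close>, the handshake identity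
  would make U dense enough for the minor.\<close>

lemma star_arboricity_bound:
  assumes G: "graph V E" and minor: "\<not> has_K_minor V E s"
  shows "star_arboricity E \<le> 2 * (2 * 2 ^ s)"
proof (rule star_arboricity_le_degenerate[OF G])
  fix U assume U: "U \<subseteq> V" "U \<noteq> {}"
  have finU: "finite U" using G U finite_subset by (auto simp: graph_def)
  have E: "\<exists>u v. e = {u, v} \<and> u \<noteq> v" if "e \<in> E" for e
    using G that unfolding graph_def by blast
  show "\<exists>v\<in>U. card (neighbours E v \<inter> U) \<le> 2 * 2 ^ s"
  proof (rule ccontr)
    assume "\<not> ?thesis"
    then have "(\<Sum>v\<in>U. 2 * 2 ^ s) \<le> (\<Sum>v\<in>U. card (neighbours E v \<inter> U))"
      by (intro sum_mono) auto
    also have "\<dots> = 2 * card {e\<in>E. e \<subseteq> U}"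
      by (rule sum_degrees[OF finU E])
    finally have "2 ^ s * card U \<le> card {e\<in>E. e \<subseteq> U}" by (simp add: mult.commute)
    then have "has_K_minor U E s"
      using dense_has_K_minor[OF finU U(2) E] by blast
    then show False
      using minor has_K_minor_mono[OF _ U(1) order_refl] by blast
  qed
qed

text \<open>The witness is a single edge: two vertices admit no three disjoint branch sets. The
  threshold is sharp, as a graph without a K_2 minor has no edges.\<close>

lemma ell_pos:
  assumes "3 \<le> s"
  shows "1 \<le> ell s"
proof -
  let ?A = "{star_arboricity E | (V :: nat set) E. graph V E \<and> \<not> has_K_minor V E s}"
  let ?E = "{{0, 1}} :: nat set set"
  have G: "graph {0, 1} ?E"
    unfolding graph_def by auto
  have "\<not> has_K_minor {0, 1} ?E s"
  proof
    assume "has_K_minor {0, 1} ?E s"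
    then have "has_K_minor {0, 1} ?E 3"
      by (rule has_K_minor_mono[OF _ order_refl assms])
    then obtain B :: "nat \<Rightarrow> nat set" where "\<forall>i<3. B i \<subseteq> {0, 1} \<and> connected_set ?E (B i)"
      and "\<forall>i<3. \<forall>j<3. i \<noteq> j \<longrightarrow> B i \<inter> B j = {} \<and> (\<exists>u\<in>B i. \<exists>v\<in>B j. {u, v} \<in> ?E)"
      unfolding has_K_minor_def by (elim exE conjE)
    then have B: "B i \<subseteq> {0, 1}" "B i \<noteq> {}" and BB: "j < 3 \<Longrightarrow> i \<noteq> j \<Longrightarrow> B i \<inter> B j = {}"
      if "i < 3" for i j :: nat
      using that unfolding connected_set_def by blast+
    have "B 0 \<inter> B 1 = {}" "B 0 \<inter> B 2 = {}" "B 1 \<inter> B 2 = {}"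
      using BB by simp_all
    moreover obtain x y z where "x \<in> B 0" "y \<in> B 1" "z \<in> B 2"
      using B(2)[of 0] B(2)[of 1] B(2)[of 2] by auto
    moreover from this have "x \<in> {0, 1}" "y \<in> {0, 1}" "z \<in> {0, 1}"
      using B(1)[of 0] B(1)[of 1] B(1)[of 2] by auto
    ultimately show False by (auto simp: disjoint_iff)
  qed
  with G have mem: "star_arboricity ?E \<in> ?A" by blast
  have bdd: "bdd_above ?A"
    using star_arboricity_bound by (intro bdd_aboveI[of _ "2 * (2 * 2 ^ s)"]) blast
  have "1 \<le> star_arboricity ?E"
  proof -
    let ?P = "\<lambda>k. \<exists>c :: nat set \<Rightarrow> nat. (\<forall>e\<in>?E. c e < k) \<and> (\<forall>i<k. star_forest {e\<in>?E. c e = i})"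
    have "star_forest ({{0, 1}} :: nat set set)"
      by (rule star_forestI[where p = "\<lambda>_. 1" and A = "{0}"]) auto
    then have "?P 1" by (intro exI[of _ "\<lambda>_. 0"]) simp
    then have "?P (LEAST k. ?P k)" by (rule LeastI)
    then have "(LEAST k. ?P k) \<noteq> 0" by auto
    then show ?thesis unfolding star_arboricity_def by linarith
  qed
  also have "\<dots> \<le> ell s"
    unfolding ell_def by (rule cSup_upper[OF mem bdd])
  finally show ?thesis .
qed

section \<open>Fundamental cuts of a spanning forest\<close>

lemma reach_insert:
  assumes "reach (insert {x, y} F) u v"
  shows "reach F u v \<or> (reach F u x \<and> reach F y v) \<or> (reach F u y \<and> reach F x v)"
  using assms unfolding reach_def[of "insert _ _"]
proof (induction rule: rtrancl_induct)
  case base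
  show ?case by (simp add: reach_refl)
next
  case (step w z)
  from step.hyps(2) have "{w, z} = {x, y} \<or> {w, z} \<in> F" by blast
  then show ?case
  proof
    assume "{w, z} = {x, y}"
    then show ?thesis
      using step.IH by (auto simp: doubleton_eq_iff intro: reach_refl)
  next
    assume "{w, z} \<in> F"
    then have "reach F w z" by (rule reach_edge)
    then show ?thesis using step.IH by (blast intro: reach_trans)
  qed
qed

text \<open>Maximality only yields some edge {u, v} on a cycle of \<open>insert {x, y} T\<close>. If
  it is not {x, y}, the detour from u to v must use {x, y} since T is acyclic; the rest of the
  detour together with {u, v} links x to y in T.\<close>

lemma spanning_forest_reach:
  assumes G: "graph V E" and T: "spanning_forest E T" and e: "{x, y} \<in> E"
  shows "reach T x y"
proof (cases "{x, y} \<in> T")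
  case True
  then show ?thesis by (rule reach_edge)
next
  case False
  then have "\<not> forest (insert {x, y} T)"
    using T e by (simp add: spanning_forest_def)
  then obtain u v where uv: "{u, v} \<in> insert {x, y} T" "reach (insert {x, y} T - {{u, v}}) u v"
    unfolding forest_def by blast
  show ?thesis
  proof (cases "{u, v} = {x, y}")
    case True
    then have "reach T u v" using uv(2) by (auto elim: reach_mono)
    then show ?thesis using True by (auto simp: doubleton_eq_iff intro: reach_sym)
  next
    case ne: False
    then have uvT: "{u, v} \<in> T" using uv(1) by blast
    have "\<not> reach (T - {{u, v}}) u v"
      using T uvT by (simp add: spanning_forest_def forest_def)
    moreover have "insert {x, y} T - {{u, v}} = insert {x, y} (T - {{u, v}})" using ne by blast
    ultimately have "(reach (T - {{u, v}}) u x \<and> reach (T - {{u, v}}) y v)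
        \<or> (reach (T - {{u, v}}) u y \<and> reach (T - {{u, v}}) x v)"
      using reach_insert[of x y "T - {{u, v}}" u v] uv(2) by simp
    moreover have "reach T a b" if "reach (T - {{u, v}}) a b" for a b
      using that by (rule reach_mono) blast
    ultimately have "(reach T u x \<and> reach T y v) \<or> (reach T u y \<and> reach T x v)" by blast
    with reach_edge[OF uvT] show ?thesis by (blast intro: reach_trans reach_sym)
  qed
qed

text \<open>T links the ends of every edge of E, so an edge leaving the \<open>a\<close> side of
  \<open>T - {{a, b}}\<close> ends on the \<open>b\<close> side. Hence the fundamental cut is an
  \<open>edge_cut\<close>, to which the parity of even sets applies.\<close>

lemma fund_cut_eq:
  assumes G: "graph V E" and T: "spanning_forest E T" and f: "{a, b} \<in> T"
    and st: "\<And>e. e \<in> E \<Longrightarrow> e = {s e, t e}"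
  shows "fund_cut E T {a, b} = E \<inter> edge_cut s t {x. reach (T - {{a, b}}) a x}"
    and "fund_cut E T {a, b} \<inter> T = {{a, b}}"
proof -
  let ?F = "T - {{a, b}}"
  have TE: "T \<subseteq> E" using T by (simp add: spanning_forest_def)
  have nab: "\<not> reach ?F a b"
    using T f by (simp add: spanning_forest_def forest_def)
  have other: "reach ?F b y" if "{x, y} \<in> E" "reach ?F a x" "\<not> reach ?F a y" for x y
  proof -
    have "reach T x y" by (rule spanning_forest_reach[OF G T that(1)])
    then have "reach T a y"
      using that(2) reach_mono[of ?F a x T] by (blast intro: reach_trans)
    moreover have "insert {a, b} ?F = T" using f by blast
    ultimately have "reach ?F a y \<or> reach ?F b y"
      using reach_insert[of a b ?F a y] by auto
    then show ?thesis using that(3) by blast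
  qed
  have separated: "\<not> reach ?F a y" if "reach ?F b y" for y
    using nab that by (blast intro: reach_trans reach_sym)
  show eq: "fund_cut E T {a, b} = E \<inter> edge_cut s t {x. reach ?F a x}"
  proof (intro equalityI subsetI)
    fix e assume "e \<in> fund_cut E T {a, b}"
    then obtain c d x y where e: "e \<in> E" "{a, b} = {c, d}" "e = {x, y}" "reach ?F c x" "reach ?F d y"
      unfolding fund_cut_def by blast
    then have "(reach ?F a x \<and> reach ?F b y) \<or> (reach ?F b x \<and> reach ?F a y)"
      by (auto simp: doubleton_eq_iff)
    then have "reach ?F a x \<noteq> reach ?F a y" using separated by blast
    moreover have "{s e, t e} = {x, y}" using st[OF e(1)] e(3) by simp
    ultimately show "e \<in> E \<inter> edge_cut s t {x. reach ?F a x}"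
      using e(1) by (auto simp: edge_cut_def doubleton_eq_iff)
  next
    fix e assume e: "e \<in> E \<inter> edge_cut s t {x. reach ?F a x}"
    then obtain x y where xy: "e = {x, y}" "reach ?F a x" "\<not> reach ?F a y"
      using st[of e] by (auto simp: edge_cut_def insert_commute)
    then have "reach ?F b y" using other e by blast
    with xy e show "e \<in> fund_cut E T {a, b}" unfolding fund_cut_def by blast
  qed
  have "e = {a, b}" if "e \<in> E \<inter> edge_cut s t {x. reach ?F a x}" "e \<in> T" for e
  proof (rule ccontr)
    assume "e \<noteq> {a, b}"
    then have "{s e, t e} \<in> ?F" using st[of e] that by auto
    then have "reach ?F (s e) (t e)" by (rule reach_edge)
    then have "reach ?F a (s e) \<longleftrightarrow> reach ?F a (t e)" by (blast intro: reach_trans reach_sym)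
    then show False using that(1) by (simp add: edge_cut_def)
  qed
  moreover have "{a, b} \<in> fund_cut E T {a, b}"
    unfolding fund_cut_def
  proof (intro CollectI conjI)
    show "{a, b} \<in> E" using f TE by blast
    show "\<exists>a' b' x y. {a, b} = {a', b'} \<and> {a, b} = {x, y} \<and> reach ?F a' x \<and> reach ?F b' y"
      by (rule exI[of _ a], rule exI[of _ b], rule exI[of _ a], rule exI[of _ b])
        (simp add: reach_refl)
  qed
  ultimately show "fund_cut E T {a, b} \<inter> T = {{a, b}}" using f unfolding eq by blast
qed

text \<open>If e alone crossed S, membership in S would be constant along a path in
  \<open>E - {e}\<close> between its ends. This connects the cut form of bridges with
  \<open>bridge\<close>.\<close>

lemma non_bridge_cut:
  assumes "\<not> bridge E e" "e \<in> E" and st: "\<And>e. e \<in> E \<Longrightarrow> e = {s e, t e}"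
  shows "E \<inter> edge_cut s t S \<noteq> {e}"
proof
  assume S: "E \<inter> edge_cut s t S = {e}"
  have "\<forall>u v. e = {u, v} \<longrightarrow> reach (E - {e}) u v"
    using assms(1,2) unfolding bridge_def by blast
  then have "reach (E - {e}) (s e) (t e)"
    using st[OF assms(2)] by (elim allE impE)
  then have "(s e \<in> S) = (t e \<in> S)"
  proof (rule reach_induct_invariant)
    fix x y assume xy: "{x, y} \<in> E - {e}"
    define d where "d = {x, y}"
    have d: "d \<in> E" "d \<noteq> e" using xy by (auto simp: d_def)
    then have "d \<notin> edge_cut s t S" using S by blast
    then have "s d \<in> S \<longleftrightarrow> t d \<in> S" by (simp add: edge_cut_def)
    moreover have "{x, y} = {s d, t d}" using st[OF d(1)] unfolding d_def .
    ultimately show "(x \<in> S) = (y \<in> S)" by (auto simp: doubleton_eq_iff)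
  qed
  then show False using S by (auto simp: edge_cut_def)
qed

text \<open>The branch sets are {u}, {v} and the component Q, in the graph without u and v, of a
  vertex x preceding v on a detour around e.\<close>

lemma non_bridge_K3_minor:
  assumes G: "graph V E" and e: "e \<in> E" "\<not> bridge E e"
  shows "has_K_minor V E 3"
proof -
  obtain u v where uv: "e = {u, v}" "u \<noteq> v" "u \<in> V" "v \<in> V"
    using G e(1) unfolding graph_def by blast
  have EV: "x \<in> V" if xy: "{x, y} \<in> E" for x y
  proof -
    obtain p q where "{x, y} = {p, q}" "p \<in> V" "q \<in> V"
      using bspec[OF conjunct2[OF G[unfolded graph_def]] xy] by (elim exE conjE)
    then show ?thesis by (auto simp: doubleton_eq_iff)
  qed
  have r: "reach (E - {e}) u v" using e uv(1) unfolding bridge_def by blast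
  \<comment> \<open>With v removed, a detour from u to v can leave the component R of u only by an
    edge into v. Its other end x differs from u because e itself is excluded.\<close>
  define F where "F = {d\<in>E - {e}. v \<notin> d}"
  define R where "R = {x. reach F u x}"
  have "v \<notin> R"
  proof
    assume "v \<in> R"
    then obtain y where "{v, y} \<in> F"
      using reach_crossing[OF reach_sym, of F u v "{v}"] uv(2) by (auto simp: R_def)
    then show False by (simp add: F_def)
  qed
  moreover have "u \<in> R" by (simp add: R_def reach_refl)
  ultimately obtain x y where xy: "{x, y} \<in> E - {e}" "x \<in> R" "y \<notin> R"
    using reach_crossing[OF r, of R] by blast
  have yv: "y = v"
  proof (rule ccontr)
    assume "y \<noteq> v"
    then have "{x, y} \<in> F" using xy \<open>v \<notin> R\<close> by (auto simp: F_def)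
    then have "y \<in> R" using xy(2) reach_trans[OF _ reach_edge] by (auto simp: R_def)
    then show False using xy(3) by simp
  qed
  have xu: "x \<noteq> u" using xy(1) uv(1) yv by auto
  \<comment> \<open>Now u is removed as well. As x is still linked to u in F, some edge leaves Q,
    and it can only go to u.\<close>
  define D where "D = {d\<in>F. u \<notin> d}"
  define Q where "Q = {z. reach D x z}"
  have xQ: "x \<in> Q" by (simp add: Q_def reach_refl)
  have uQ: "u \<notin> Q"
  proof
    assume "u \<in> Q"
    then obtain z where "{u, z} \<in> D"
      using reach_crossing[OF reach_sym, of D x u "{u}"] xu by (auto simp: Q_def)
    then show False by (simp add: D_def)
  qed
  have QR: "Q \<subseteq> R"
  proof
    fix z assume "z \<in> Q"
    then have "reach F x z" unfolding Q_def by (auto simp: D_def elim: reach_mono)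
    then show "z \<in> R" using xy(2) reach_trans by (auto simp: R_def)
  qed
  have "reach F x u" using xy(2) by (auto simp: R_def intro: reach_sym)
  then obtain z w where zw: "{z, w} \<in> F" "z \<in> Q" "w \<notin> Q"
    using xQ uQ by (rule reach_crossing)
  have wu: "w = u"
  proof (rule ccontr)
    assume "w \<noteq> u"
    then have "{z, w} \<in> D" using zw uQ by (auto simp: D_def)
    then have "w \<in> Q" using zw(2) reach_trans[OF _ reach_edge] by (auto simp: Q_def)
    then show False using zw(3) by simp
  qed
  have conQ: "connected_set E Q"
    unfolding connected_set_def
  proof (intro conjI ballI)
    show "Q \<noteq> {}" using xQ by blast
    have from_x: "reach {d\<in>E. d \<subseteq> Q} x z" if "z \<in> Q" for z
    proof -
      have "(x, z) \<in> {(x, y). {x, y} \<in> D}\<^sup>*" using that by (simp add: Q_def reach_def)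
      then show ?thesis
      proof (induction rule: rtrancl_induct)
        case (step y z)
        then have "y \<in> Q" by (simp add: Q_def reach_def)
        moreover have yz: "{y, z} \<in> D" using step.hyps(2) by simp
        ultimately have "z \<in> Q" using reach_trans[OF _ reach_edge] by (auto simp: Q_def)
        then have "{y, z} \<in> {d\<in>E. d \<subseteq> Q}" using \<open>y \<in> Q\<close> yz by (simp add: D_def F_def)
        then show ?case using step.IH by (blast intro: reach_trans reach_edge)
      qed (rule reach_refl)
    qed
    show "reach {d\<in>E. d \<subseteq> Q} y z" if "y \<in> Q" "z \<in> Q" for y z
      using from_x[OF that(1)] from_x[OF that(2)] by (blast intro: reach_trans reach_sym)
  qed
  have QV: "Q \<subseteq> V"
  proof
    fix z assume z: "z \<in> Q"
    show "z \<in> V"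
    proof (cases "z = x")
      case True
      then show ?thesis using EV[of x y] xy(1) by blast
    next
      case False
      then obtain w where "{z, w} \<in> D"
        using reach_crossing[OF reach_sym, of D x z "{z}"] z by (auto simp: Q_def)
      then show ?thesis using EV[of z w] by (simp add: D_def F_def)
    qed
  qed
  have single: "connected_set E {z}" for z by (simp add: connected_set_def reach_refl)
  have vQ: "v \<notin> Q" using QR \<open>v \<notin> R\<close> by blast
  have adj: "{u, v} \<in> E" "{v, u} \<in> E" "{x, v} \<in> E" "{v, x} \<in> E" "{z, u} \<in> E" "{u, z} \<in> E"
    using e(1) uv(1) xy(1) yv zw(1) wu by (auto simp: F_def insert_commute)
  let ?B = "(\<lambda>i. if i = 0 then {u} else if i = 1 then {v} else Q) :: nat \<Rightarrow> 'a set"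
  show ?thesis
    unfolding has_K_minor_def
  proof (rule exI[of _ ?B], rule conjI, goal_cases)
    case 1
    show ?case using uv(3,4) QV single conQ by simp
  next
    case 2
    have less3: "i < 3 \<longleftrightarrow> i = 0 \<or> i = 1 \<or> i = 2" for i :: nat by auto
    show ?case
      unfolding less3 using adj uv(2) uQ vQ xQ zw(2) by (auto intro: bexI[of _ x] bexI[of _ z])
  qed
qed

lemma even_card_preimage:
  assumes "finite N" "finite I" "\<And>i. i \<in> I \<Longrightarrow> even (card {e\<in>N. \<phi> e = i})"
  shows "even (card {e\<in>N. \<phi> e \<in> I})"
  using assms(2,3)
proof (induction I rule: finite_induct)
  case (insert i I)
  have "{e\<in>N. \<phi> e \<in> insert i I} = {e\<in>N. \<phi> e = i} \<union> {e\<in>N. \<phi> e \<in> I}" by blast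
  moreover have "{e\<in>N. \<phi> e = i} \<inter> {e\<in>N. \<phi> e \<in> I} = {}" using insert.hyps by blast
  ultimately have "card {e\<in>N. \<phi> e \<in> insert i I} = card {e\<in>N. \<phi> e = i} + card {e\<in>N. \<phi> e \<in> I}"
    using assms(1) by (simp add: card_Un_disjoint)
  then show ?case using insert by simp
qed simp

text \<open>A colour encodes the membership of an edge in the three even sets of the cover.\<close>

lemma odd_cut_colouring:
  assumes G: "graph V E" and T: "spanning_forest E T"
  shows "\<exists>\<phi> :: 'a set \<Rightarrow> nat. (\<forall>e\<in>E - T. \<phi> e \<in> {1..8}) \<and>
    (\<forall>f\<in>T. \<not> bridge E f \<longrightarrow> (\<exists>i\<in>{1..8}. odd (card {e \<in> fund_cut E T f - T. \<phi> e = i})))"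
proof -
  have "\<forall>e\<in>E. \<exists>u v. e = {u, v} \<and> u \<in> V \<and> v \<in> V"
    using G unfolding graph_def by blast
  then obtain s t where st: "\<forall>e\<in>E. e = {s e, t e} \<and> s e \<in> V \<and> t e \<in> V"
    by metis
  have ends: "e = {s e, t e}" "s e \<in> V \<and> t e \<in> V" if "e \<in> E" for e
    using bspec[OF st that] by (rule conjunct1, rule conjunct2)
  have finV: "finite V" using G by (simp add: graph_def)
  have "E \<subseteq> Pow V"
  proof
    fix e assume "e \<in> E"
    then have "{s e, t e} \<in> Pow V" using ends(2) by simp
    then show "e \<in> Pow V" using ends(1)[OF \<open>e \<in> E\<close>] by (rule ssubst[rotated])
  qed
  then have finE: "finite E" using finV by (simp add: finite_subset)
  have "\<exists>A B C. even_set s t A \<and> even_set s t B \<and> even_set s t C \<and> A \<subseteq> E \<and> B \<subseteq> E \<and> C \<subseteq> E \<and>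
      (\<forall>e\<in>E. (\<exists>S. E \<inter> edge_cut s t S = {e}) \<or> e \<in> A \<union> B \<union> C)"
    by (rule even_cover_non_bridges[OF finV finE]) (rule ends(2))
  then obtain A B C where ABC: "even_set s t A" "even_set s t B" "even_set s t C"
      "A \<subseteq> E" "B \<subseteq> E" "C \<subseteq> E"
    and cover: "\<forall>e\<in>E. (\<exists>S. E \<inter> edge_cut s t S = {e}) \<or> e \<in> A \<union> B \<union> C"
    by (elim exE conjE)
  \<comment> \<open>The three memberships are the binary digits of \<open>\<phi> e - 1\<close>; the
    shift moves 0..7 to 1..8.\<close>
  define \<phi> :: "'a set \<Rightarrow> nat" where
    "\<phi> e = 1 + of_bool (e \<in> A) + 2 * of_bool (e \<in> B) + 4 * of_bool (e \<in> C)" for e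
  have decode: "e \<in> A \<longleftrightarrow> \<phi> e \<in> {2, 4, 6, 8}" "e \<in> B \<longleftrightarrow> \<phi> e \<in> {3, 4, 7, 8}"
      "e \<in> C \<longleftrightarrow> \<phi> e \<in> {5, 6, 7, 8}" for e
    by (cases "e \<in> A"; cases "e \<in> B"; cases "e \<in> C"; simp add: \<phi>_def)+
  have range: "\<phi> e \<in> {1..8}" for e
    by (simp add: \<phi>_def of_bool_def)
  have "\<exists>i\<in>{1..8}. odd (card {e \<in> fund_cut E T f - T. \<phi> e = i})"
    if f: "f \<in> T" "\<not> bridge E f" for f
  proof (rule ccontr)
    let ?K = "fund_cut E T f"
    assume "\<not> ?thesis"
    then have even: "even (card {e \<in> ?K - T. \<phi> e = i})" if "i \<in> {1..8}" for i
      using that by blast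
    have fE: "f \<in> E" using f(1) T by (auto simp: spanning_forest_def)
    have f': "f = {s f, t f}" by (rule ends(1)[OF fE])
    then have fT: "{s f, t f} \<in> T" using f(1) by simp
    obtain S where K: "?K = E \<inter> edge_cut s t S" and KT: "?K \<inter> T = {f}"
      using fund_cut_eq[where s = s and t = t, OF G T fT ends(1)]
      unfolding f'[symmetric] by blast
    have finK: "finite ?K" unfolding K using finE by simp
    \<comment> \<open>Since f is the only tree edge in the cut, an even set through f contains an
      odd number of non-tree cut edges. These are the ones with colour in I, and every colour class
      there is assumed even.\<close>
    have notin: "f \<notin> X"
      if X: "even_set s t X" "X \<subseteq> E" "\<And>e. e \<in> X \<longleftrightarrow> \<phi> e \<in> I" and I: "I \<subseteq> {1..8}" for X I
    proof
      assume fX: "f \<in> X"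
      have "finite I" using I by (rule finite_subset) simp
      then have "even (card {e \<in> ?K - T. \<phi> e \<in> I})"
        using finK even I by (intro even_card_preimage) auto
      moreover have "X \<inter> edge_cut s t S = insert f {e \<in> ?K - T. \<phi> e \<in> I}"
        using X(2,3) fX KT K by blast
      moreover have "f \<notin> {e \<in> ?K - T. \<phi> e \<in> I}" using f(1) by blast
      ultimately have "odd (card (X \<inter> edge_cut s t S))" using finK by simp
      then show False using X(1) by (simp add: even_set_def)
    qed
    have "f \<notin> A" by (rule notin[OF ABC(1,4) decode(1)]) simp
    moreover have "f \<notin> B" by (rule notin[OF ABC(2,5) decode(2)]) simp
    moreover have "f \<notin> C" by (rule notin[OF ABC(3,6) decode(3)]) simp
    moreover have "\<not> (\<exists>S. E \<inter> edge_cut s t S = {f})"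
      using non_bridge_cut[where s = s and t = t, OF f(2) fE ends(1)] by blast
    ultimately show False using cover fE by blast
  qed
  then show ?thesis using range by blast
qed

theorem theorem1p5:
  fixes t :: nat
  shows "\<exists>k::nat. k \<le> 16 * ell (t - 1) + 1 \<and>
    (\<forall>(V :: 'a set) E T. graph V E \<and> \<not> has_K_minor V E t \<and> spanning_forest E T \<longrightarrow>
      (\<exists>\<phi> :: 'a set \<Rightarrow> nat. (\<forall>e\<in>E - T. \<phi> e \<in> {1..k}) \<and>
        (\<forall>f\<in>T. \<not> bridge E f \<longrightarrow>
           (\<exists>i\<in>{1..k}. odd (card {e \<in> fund_cut E T f - T. \<phi> e = i})))))"
proof (cases "4 \<le> t")
  case True
  then have "1 \<le> ell (t - 1)" by (intro ell_pos) linarith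
  then have "8 \<le> 16 * ell (t - 1) + 1" by linarith
  then show ?thesis using odd_cut_colouring by (intro exI[of _ 8]) blast
next
  case False
  have bridges: "bridge E f"
    if "graph V E" "\<not> has_K_minor V E t" "spanning_forest E T" "f \<in> T"
    for V :: "'a set" and E T f
  proof (rule ccontr)
    assume "\<not> bridge E f"
    moreover have "f \<in> E" using that by (auto simp: spanning_forest_def)
    ultimately have "has_K_minor V E 3" using non_bridge_K3_minor that(1) by blast
    then show False using has_K_minor_mono[of V E 3 V t] False that(2) by simp
  qed
  show ?thesis
  \<comment> \<open>For \<open>t \<le> 3\<close> the value \<open>ell (t - 1)\<close> is 0: the
    graphs in question have no edges, or there are none and the supremum of the empty set is 0. So
    the bound allows just one colour.\<close>
  proof (rule exI[of _ 1], intro conjI allI impI)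
    fix V :: "'a set" and E T
    assume "graph V E \<and> \<not> has_K_minor V E t \<and> spanning_forest E T"
    then have "\<forall>f\<in>T. bridge E f" using bridges by blast
    then show "\<exists>\<phi> :: 'a set \<Rightarrow> nat. (\<forall>e\<in>E - T. \<phi> e \<in> {1..1}) \<and> (\<forall>f\<in>T. \<not> bridge E f \<longrightarrow>
        (\<exists>i\<in>{1..1}. odd (card {e \<in> fund_cut E T f - T. \<phi> e = i})))"
      by (intro exI[of _ "\<lambda>_. 1"]) simp
  qed simp
qed

end
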